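(* Let $n\ge 2$, let $\mathfrak g$ be a finite dimensional simple Lie algebra over $\mathbb C$ with a non-degenerate invariant symmetric bilinear form $(\cdot,\cdot)$, and let $\overline\tau=\mathfrak g\otimes A\oplus\sum_{i=1}^n\mathbb C K_i\oplus\sum_{i=1}^n\mathbb C d_i$, with $A=\mathbb C[t_1^{\pm1},\dots,t_n^{\pm1}]$, be the Lie algebra with brackets $$[X(\underline r),Y(\underline s)]=[X,Y](\underline r+\underline s)+(X,Y)\,\delta_{\underline r+\underline s,0}\sum_i r_iK_i,$$ $K_1,\dots,K_n$ central, $[d_i,X(\underline r)]=r_iX(\underline r)$, $[d_i,d_j]=0$, for $X,Y\in\mathfrak g$, $\underline r,\underline s\in\mathbb Z^n$. Then there does not exist a weight module $V$ for $\overline\tau$ with finite dimensional weight spaces which is generated by a weight vector on which at least one $K_i$ acts non-trivially.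
   Context: $X(\underline r)=X\otimes t^{\underline r}$ with $t^{\underline r}=t_1^{r_1}\cdots t_n^{r_n}$. Let $\mathfrak h$ be a Cartan subalgebra of $\mathfrak g$ and let $\tilde{\mathfrak h}$ be the span of $\mathfrak h,K_1,\dots,K_n,d_1,\dots,d_n$. Weight modules, weight vectors and weight spaces are with respect to $\tilde{\mathfrak h}$ (a weight module is the direct sum of its simultaneous eigenspaces for $\tilde{\mathfrak h}$). *)

theory Defs
  imports "HOL-Analysis.Cartesian_Space" "HOL-Library.Poly_Mapping"
begin

locale complex_lie_algebra = vector_space scal
  for scal :: "complex \<Rightarrow> 'a::ab_group_add \<Rightarrow> 'a" +
  fixes bracket :: "'a \<Rightarrow> 'a \<Rightarrow> 'a"
  assumes linear_bracket_left: "Vector_Spaces.linear scal scal (\<lambda>x. bracket x y)"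
    and linear_bracket_right: "Vector_Spaces.linear scal scal (\<lambda>y. bracket x y)"
    and bracket_self: "bracket x x = 0"
    and jacobi: "bracket x (bracket y z) + bracket y (bracket z x) + bracket z (bracket x y) = 0"
begin

definition finite_dim :: "'a set \<Rightarrow> bool" where
  "finite_dim S \<longleftrightarrow> (\<exists>B. finite B \<and> span B = S)"

definition lie_subalgebra :: "'a set \<Rightarrow> bool" where
  "lie_subalgebra H \<longleftrightarrow> subspace H \<and> (\<forall>x\<in>H. \<forall>y\<in>H. bracket x y \<in> H)"

definition lie_ideal :: "'a set \<Rightarrow> bool" where
  "lie_ideal I \<longleftrightarrow> subspace I \<and> (\<forall>x. \<forall>y\<in>I. bracket x y \<in> I)"

definition simple :: bool where
  "simple \<longleftrightarrow> (\<exists>x y. bracket x y \<noteq> 0) \<and> (\<forall>I. lie_ideal I \<longrightarrow> I = {0} \<or> I = UNIV)"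

primrec lower_central :: "'a set \<Rightarrow> nat \<Rightarrow> 'a set" where
  "lower_central H 0 = H"
| "lower_central H (Suc k) = span {bracket x y | x y. x \<in> H \<and> y \<in> lower_central H k}"

definition nilpotent :: "'a set \<Rightarrow> bool" where
  "nilpotent H \<longleftrightarrow> (\<exists>k. lower_central H k = {0})"

definition normalizer :: "'a set \<Rightarrow> 'a set" where
  "normalizer H = {x. \<forall>y\<in>H. bracket x y \<in> H}"

definition cartan_subalgebra :: "'a set \<Rightarrow> bool" where
  "cartan_subalgebra H \<longleftrightarrow> lie_subalgebra H \<and> nilpotent H \<and> normalizer H = H"

definition bilinear_form :: "('a \<Rightarrow> 'a \<Rightarrow> complex) \<Rightarrow> bool" where
  "bilinear_form f \<longleftrightarrow>
     (\<forall>y. Vector_Spaces.linear scal (*) (\<lambda>x. f x y)) \<and>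
     (\<forall>x. Vector_Spaces.linear scal (*) (\<lambda>y. f x y))"

definition invariant_form :: "('a \<Rightarrow> 'a \<Rightarrow> complex) \<Rightarrow> bool" where
  "invariant_form f \<longleftrightarrow> (\<forall>x y z. f (bracket x y) z = f x (bracket y z))"

end

locale simple_lie_algebra_with_form = complex_lie_algebra scal bracket
  for scal :: "complex \<Rightarrow> 'g::ab_group_add \<Rightarrow> 'g" and bracket +
  fixes form :: "'g \<Rightarrow> 'g \<Rightarrow> complex"
  assumes finite_dim_UNIV: "finite_dim UNIV"
    and simple: simple
    and bilinear_form: "bilinear_form form"
    and invariant_form: "invariant_form form"
    and symmetric_form: "form x y = form y x"
    and nondegenerate_form: "(\<And>y. form x y = 0) \<Longrightarrow> x = 0"

text \<open>
  The index type \<open>'n\<close> plays the role of \<open>{1,\<dots>,n}\<close>. An element of \<open>\<gg> \<otimes> A\<close> is the finitely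
  supported family of its coefficients in \<open>\<gg>\<close>, so that \<open>X \<otimes> t\<^sup>r\<close> is \<open>Poly_Mapping.single r X\<close>;
  the triple \<open>(p, k, d)\<close> stands for \<open>p + (\<Sum>i. k $ i K\<^sub>i) + (\<Sum>i. d $ i d\<^sub>i)\<close>.
\<close>

type_synonym ('g, 'n) toroidal = "((int ^ 'n) \<Rightarrow>\<^sub>0 'g) \<times> (complex ^ 'n) \<times> (complex ^ 'n)"

definition loop_elt :: "'g::ab_group_add \<Rightarrow> int ^ 'n \<Rightarrow> ('g, 'n::finite) toroidal" where
  "loop_elt X r = (Poly_Mapping.single r X, 0, 0)"

definition central_elt :: "'n \<Rightarrow> ('g::ab_group_add, 'n::finite) toroidal" where
  "central_elt i = (0, axis i 1, 0)"

definition degree_derivation :: "'n \<Rightarrow> ('g::ab_group_add, 'n::finite) toroidal" where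
  "degree_derivation i = (0, 0, axis i 1)"

definition toroidal_scale ::
    "(complex \<Rightarrow> 'g::ab_group_add \<Rightarrow> 'g) \<Rightarrow> complex \<Rightarrow> ('g, 'n::finite) toroidal \<Rightarrow> ('g, 'n) toroidal" where
  "toroidal_scale scal c = (\<lambda>(p, k, d). (Poly_Mapping.map (scal c) p, c *s k, c *s d))"

definition loop_bracket ::
    "('g \<Rightarrow> 'g \<Rightarrow> 'g::ab_group_add) \<Rightarrow> ((int ^ 'n) \<Rightarrow>\<^sub>0 'g) \<Rightarrow> ((int ^ 'n) \<Rightarrow>\<^sub>0 'g) \<Rightarrow> ((int ^ 'n) \<Rightarrow>\<^sub>0 'g)" where
  "loop_bracket bracket p q =
     (\<Sum>r\<in>Poly_Mapping.keys p. \<Sum>s\<in>Poly_Mapping.keys q.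
        Poly_Mapping.single (r + s) (bracket (Poly_Mapping.lookup p r) (Poly_Mapping.lookup q s)))"

definition loop_cocycle ::
    "('g \<Rightarrow> 'g::ab_group_add \<Rightarrow> complex) \<Rightarrow> ((int ^ 'n) \<Rightarrow>\<^sub>0 'g) \<Rightarrow> ((int ^ 'n) \<Rightarrow>\<^sub>0 'g) \<Rightarrow> complex ^ 'n::finite" where
  "loop_cocycle form p q =
     (\<Sum>r\<in>Poly_Mapping.keys p. \<Sum>s\<in>Poly_Mapping.keys q.
        if r + s = 0
        then form (Poly_Mapping.lookup p r) (Poly_Mapping.lookup q s) *s (\<chi> i. of_int (r $ i))
        else 0)"

text \<open>The action of \<open>\<Sum>i. d $ i d\<^sub>i\<close> on \<open>\<gg> \<otimes> A\<close>.\<close>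

definition loop_derivation ::
    "(complex \<Rightarrow> 'g::ab_group_add \<Rightarrow> 'g) \<Rightarrow> complex ^ 'n::finite \<Rightarrow> ((int ^ 'n) \<Rightarrow>\<^sub>0 'g) \<Rightarrow> ((int ^ 'n) \<Rightarrow>\<^sub>0 'g)" where
  "loop_derivation scal d p =
     (\<Sum>r\<in>Poly_Mapping.keys p.
        Poly_Mapping.single r (scal (\<Sum>i\<in>UNIV. d $ i * of_int (r $ i)) (Poly_Mapping.lookup p r)))"

definition toroidal_bracket ::
    "(complex \<Rightarrow> 'g::ab_group_add \<Rightarrow> 'g) \<Rightarrow> ('g \<Rightarrow> 'g \<Rightarrow> 'g) \<Rightarrow> ('g \<Rightarrow> 'g \<Rightarrow> complex) \<Rightarrow>
     ('g, 'n::finite) toroidal \<Rightarrow> ('g, 'n) toroidal \<Rightarrow> ('g, 'n) toroidal" where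
  "toroidal_bracket scal bracket form = (\<lambda>(p, k, d) (p', k', d').
     (loop_bracket bracket p p' + loop_derivation scal d p' - loop_derivation scal d' p,
      loop_cocycle form p p',
      0))"

definition toroidal_cartan ::
    "(complex \<Rightarrow> 'g::ab_group_add \<Rightarrow> 'g) \<Rightarrow> 'g set \<Rightarrow> ('g, 'n::finite) toroidal set" where
  "toroidal_cartan scal H =
     module.span (toroidal_scale scal)
       ((\<lambda>X. loop_elt X 0) ` H \<union> range central_elt \<union> range degree_derivation)"

lemma sum_keys_superset:
  assumes "finite S" "Poly_Mapping.keys p \<subseteq> S" "\<And>r. F r 0 = (0::'b::comm_monoid_add)"
  shows "(\<Sum>r\<in>Poly_Mapping.keys p. F r (Poly_Mapping.lookup p r)) = (\<Sum>r\<in>S. F r (Poly_Mapping.lookup p r))"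
  by (rule sum.mono_neutral_left) (use assms in \<open>auto simp: in_keys_iff\<close>)

lemma sum_keys_add:
  fixes F :: "'k \<Rightarrow> 'a::monoid_add \<Rightarrow> 'b::comm_monoid_add"
  assumes "\<And>r. F r 0 = 0" "\<And>r x y. F r (x + y) = F r x + F r y"
  shows "(\<Sum>r\<in>Poly_Mapping.keys (p + q). F r (Poly_Mapping.lookup (p + q) r)) =
         (\<Sum>r\<in>Poly_Mapping.keys p. F r (Poly_Mapping.lookup p r)) +
         (\<Sum>r\<in>Poly_Mapping.keys q. F r (Poly_Mapping.lookup q r))"
proof -
  let ?S = "Poly_Mapping.keys p \<union> Poly_Mapping.keys q"
  have "Poly_Mapping.keys (p + q) \<subseteq> ?S" by (rule Poly_Mapping.keys_add)
  then show ?thesis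
    using assms
    by (subst (1 2 3) sum_keys_superset[where S = ?S]) (auto simp: lookup_add sum.distrib)
qed

lemma sum_keys_single:
  assumes "\<And>r. F r 0 = (0::'b::comm_monoid_add)"
  shows "(\<Sum>r\<in>Poly_Mapping.keys (Poly_Mapping.single s x).
           F r (Poly_Mapping.lookup (Poly_Mapping.single s x) r)) = F s x"
  using assms by (cases "x = 0") auto

lemma poly_mapping_additive_induct [case_names zero add single]:
  fixes p :: "'k \<Rightarrow>\<^sub>0 'a::ab_group_add"
  assumes zero: "P 0"
    and add: "\<And>p q. P p \<Longrightarrow> P q \<Longrightarrow> P (p + q)"
    and single: "\<And>r x. P (Poly_Mapping.single r x)"
  shows "P p"
proof -
  have *: "P (\<Sum>r\<in>S. Poly_Mapping.single r (Poly_Mapping.lookup p r))" if "finite S" for S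
    using that by (induction S rule: finite_induct) (auto intro: zero add single)
  have "(\<Sum>r\<in>Poly_Mapping.keys p. Poly_Mapping.single r (Poly_Mapping.lookup p r)) = p"
    by (rule poly_mapping_eqI)
      (auto simp: lookup_sum lookup_single when_def sum.delta in_keys_iff)
  then show ?thesis using *[of "Poly_Mapping.keys p"] by simp
qed

lemma vector_space_linear_iff:
  assumes "vector_space s1" "vector_space s2"
  shows "Vector_Spaces.linear s1 s2 f \<longleftrightarrow>
    (\<forall>x y. f (x + y) = f x + f y) \<and> (\<forall>c x. f (s1 c x) = s2 c (f x))"
  using assms by (simp add: Vector_Spaces.linear_iff)

lemma sum3_eq_0:
  "a + b + c = 0 \<Longrightarrow> a' + b' + c' = 0 \<Longrightarrow> a + a' + (b + b') + (c + c') = (0 :: 'a::ab_group_add)"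
  by (metis (no_types, opaque_lifting) add.assoc add.commute add.right_neutral)

context simple_lie_algebra_with_form
begin

lemma bracket_add: "bracket (x + y) z = bracket x z + bracket y z"
    "bracket x (y + z) = bracket x y + bracket x z"
  and bracket_scal: "bracket (scal c x) z = scal c (bracket x z)"
    "bracket x (scal c z) = scal c (bracket x z)"
  using linear_bracket_left linear_bracket_right
  by (simp_all add: vector_space_linear_iff[OF vector_space_axioms vector_space_axioms])

lemma bracket_zero [simp]: "bracket 0 x = 0" "bracket x 0 = 0"
  using bracket_add(1)[of 0 0 x] bracket_add(2)[of x 0 0] by simp_all

lemma bracket_swap: "bracket y x = - bracket x y"
  using bracket_self[of "x + y"] bracket_self[of x] bracket_self[of y]
  by (simp add: bracket_add eq_neg_iff_add_eq_0 add.commute)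

lemma form_add: "form (x + y) z = form x z + form y z" "form x (y + z) = form x y + form x z"
  and form_scal: "form (scal c x) z = c * form x z" "form x (scal c z) = c * form x z"
proof -
  have "vector_space ((*) :: complex \<Rightarrow> complex \<Rightarrow> complex)"
    by unfold_locales (auto simp: algebra_simps)
  from vector_space_linear_iff[OF vector_space_axioms this] bilinear_form
  show "form (x + y) z = form x z + form y z" "form x (y + z) = form x y + form x z"
    "form (scal c x) z = c * form x z" "form x (scal c z) = c * form x z"
    by (auto simp: bilinear_form_def)
qed

lemma form_zero [simp]: "form 0 x = 0" "form x 0 = 0"
  using form_add(1)[of 0 0 x] form_add(2)[of x 0 0] by simp_all

lemma form_neg [simp]: "form (- x) y = - form x y" "form x (- y) = - form x y"
  using form_add(1)[of "-x" x y] form_add(2)[of x "-y" y] by (simp_all add: eq_neg_iff_add_eq_0)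

lemma form_cyclic: "form x (bracket y z) = form y (bracket z x)"
  using invariant_form symmetric_form unfolding invariant_form_def by metis

abbreviation L where "L \<equiv> loop_bracket bracket"
abbreviation W where "W \<equiv> loop_cocycle form"
abbreviation D where "D \<equiv> loop_derivation scal"
abbreviation M where "M \<equiv> (\<lambda>c. Poly_Mapping.map (scal c))"

lemma D_add: "D d (p + q) = D d p + D d q"
  unfolding loop_derivation_def
  by (rule sum_keys_add[where F = "\<lambda>r x. Poly_Mapping.single r (scal (\<Sum>i\<in>UNIV. d $ i * of_int (r $ i)) x)"])
    (simp_all add: scale_right_distrib single_add)

lemma D_single: "D d (Poly_Mapping.single r x) =
    Poly_Mapping.single r (scal (\<Sum>i\<in>UNIV. d $ i * of_int (r $ i)) x)"
  unfolding loop_derivation_def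
  by (rule sum_keys_single[where F = "\<lambda>r x. Poly_Mapping.single r (scal (\<Sum>i\<in>UNIV. d $ i * of_int (r $ i)) x)"]) simp

lemma L_add_left: "L (p + p') q = L p q + L p' q"
  unfolding loop_bracket_def
  by (rule sum_keys_add[where F = "\<lambda>r x. \<Sum>s\<in>Poly_Mapping.keys q.
        Poly_Mapping.single (r + s) (bracket x (Poly_Mapping.lookup q s))"])
    (simp_all add: bracket_add single_add sum.distrib)

lemma L_swap_sum: "L p q = (\<Sum>s\<in>Poly_Mapping.keys q. \<Sum>r\<in>Poly_Mapping.keys p.
        Poly_Mapping.single (r + s) (bracket (Poly_Mapping.lookup p r) (Poly_Mapping.lookup q s)))"
  unfolding loop_bracket_def by (rule sum.swap)

lemma L_add_right: "L p (q + q') = L p q + L p q'"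
  unfolding L_swap_sum
  by (rule sum_keys_add[where F = "\<lambda>s x. \<Sum>r\<in>Poly_Mapping.keys p.
        Poly_Mapping.single (r + s) (bracket (Poly_Mapping.lookup p r) x)"])
    (simp_all add: bracket_add single_add sum.distrib)

lemma L_single: "L (Poly_Mapping.single r x) (Poly_Mapping.single s y) =
    Poly_Mapping.single (r + s) (bracket x y)"
  unfolding loop_bracket_def by (cases "x = 0"; cases "y = 0") simp_all

lemma W_add_left: "W (p + p') q = W p q + W p' q"
  unfolding loop_cocycle_def
  by (rule sum_keys_add[where F = "\<lambda>r x. \<Sum>s\<in>Poly_Mapping.keys q.
        if r + s = 0 then form x (Poly_Mapping.lookup q s) *s (\<chi> i. of_int (r $ i)) else 0"])
    (simp_all add: form_add vector_sadd_rdistrib flip: sum.distrib,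
     auto intro!: sum.neutral sum.cong simp: form_add vector_sadd_rdistrib)

lemma W_swap_sum: "W p q = (\<Sum>s\<in>Poly_Mapping.keys q. \<Sum>r\<in>Poly_Mapping.keys p.
        if r + s = 0 then form (Poly_Mapping.lookup p r) (Poly_Mapping.lookup q s) *s (\<chi> i. of_int (r $ i)) else 0)"
  unfolding loop_cocycle_def by (rule sum.swap)

lemma W_add_right: "W p (q + q') = W p q + W p q'"
  unfolding W_swap_sum
  by (rule sum_keys_add[where F = "\<lambda>s x. \<Sum>r\<in>Poly_Mapping.keys p.
        if r + s = 0 then form (Poly_Mapping.lookup p r) x *s (\<chi> i. of_int (r $ i)) else 0"])
    (simp_all add: form_add vector_sadd_rdistrib flip: sum.distrib,
     auto intro!: sum.neutral sum.cong simp: form_add vector_sadd_rdistrib)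

lemma W_single: "W (Poly_Mapping.single r x) (Poly_Mapping.single s y) =
    (if r + s = 0 then form x y *s (\<chi> i. of_int (r $ i)) else 0)"
  unfolding loop_cocycle_def by (cases "x = 0"; cases "y = 0") simp_all

lemma zeros [simp]: "D d 0 = 0" "L 0 q = 0" "L p 0 = 0" "W 0 q = 0" "W p 0 = 0"
  by (simp_all add: loop_derivation_def loop_bracket_def loop_cocycle_def)

lemma D_uminus: "D d (- p) = - D d p"
  using D_add[of d "-p" p] by (simp add: eq_neg_iff_add_eq_0)
lemma L_uminus: "L (- p) q = - L p q" "L p (- q) = - L p q"
  using L_add_left[of "-p" p q] L_add_right[of p "-q" q] by (simp_all add: eq_neg_iff_add_eq_0)
lemma W_uminus: "W (- p) q = - W p q" "W p (- q) = - W p q"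
  using W_add_left[of "-p" p q] W_add_right[of p "-q" q] by (simp_all add: eq_neg_iff_add_eq_0)
lemma D_diff: "D d (p - q) = D d p - D d q"
  using D_add[of d p "-q"] by (simp add: D_uminus)
lemma L_diff: "L (p - p') q = L p q - L p' q" "L p (q - q') = L p q - L p q'"
  using L_add_left[of p "-p'" q] L_add_right[of p q "-q'"] by (simp_all add: L_uminus)
lemma W_diff: "W (p - p') q = W p q - W p' q" "W p (q - q') = W p q - W p q'"
  using W_add_left[of p "-p'" q] W_add_right[of p q "-q'"] by (simp_all add: W_uminus)

lemma M_lookup: "Poly_Mapping.lookup (M c p) r = scal c (Poly_Mapping.lookup p r)"
  by (simp add: Poly_Mapping.map.rep_eq when_def)

lemma M_add: "M c (p + q) = M c p + M c q"
  by (rule poly_mapping_eqI) (simp add: M_lookup lookup_add scale_right_distrib)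

lemma M_uminus: "M c (- p) = - M c p"
  by (rule poly_mapping_eqI) (simp add: M_lookup)
lemma M_diff: "M c (p - q) = M c p - M c q"
  using M_add[of c p "-q"] by (simp add: M_uminus)

lemma M_single: "M c (Poly_Mapping.single r x) = Poly_Mapping.single r (scal c x)"
  by (rule poly_mapping_eqI) (simp add: M_lookup lookup_single when_def)

lemma M_zero [simp]: "M c 0 = 0"
  by (rule poly_mapping_eqI) (simp add: M_lookup)

lemma D_M: "D d (M c p) = M c (D d p)"
  by (induction p rule: poly_mapping_additive_induct)
    (simp_all add: D_add M_add M_single D_single mult.commute)

lemma L_M_left: "L (M c p) q = M c (L p q)"
proof (induction p rule: poly_mapping_additive_induct)
  case (single r x)
  show ?case
    by (induction q rule: poly_mapping_additive_induct)
      (simp_all add: M_add L_add_right M_single L_single bracket_scal)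
qed (simp_all add: L_add_left M_add)

lemma L_anti: "L q p = - L p q"
proof (induction p rule: poly_mapping_additive_induct)
  case (single r x)
  show ?case
    by (induction q rule: poly_mapping_additive_induct)
      (simp_all add: L_add_right L_add_left L_single add.commute bracket_swap[of x] single_uminus)
qed (simp_all add: L_add_left L_add_right)

lemma L_M_right: "L p (M c q) = M c (L p q)"
  using L_anti[of "M c q" p] L_anti[of q p] by (simp add: L_M_left M_uminus)

lemma L_self: "L p p = 0"
proof (rule poly_mapping_eqI)
  fix r
  let ?a = "Poly_Mapping.lookup (L p p) r"
  have "?a = - ?a" by (subst L_anti) simp
  then have "?a + ?a = 0" by (metis add.left_inverse)
  then have "scal (1 + 1) ?a = 0" by (simp only: scale_left_distrib scale_one)
  then show "?a = Poly_Mapping.lookup 0 r" by simp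
qed

lemma W_M_left: "W (M c p) q = c *s W p q"
proof (induction p rule: poly_mapping_additive_induct)
  case (single r x)
  show ?case
    by (induction q rule: poly_mapping_additive_induct)
      (simp_all add: W_add_right M_single W_single form_scal vector_add_ldistrib vector_smult_assoc)
qed (simp_all add: W_add_left M_add vector_add_ldistrib)

lemma W_anti: "W q p = - W p q"
proof (induction p rule: poly_mapping_additive_induct)
  case (single r x)
  show ?case
  proof (induction q rule: poly_mapping_additive_induct)
    case (single s y)
    have "r = - s" if "s + r = 0" using that by (simp add: eq_neg_iff_add_eq_0 add.commute)
    then show ?case
      by (auto simp: W_single add.commute[of r] symmetric_form[of y] vec_eq_iff)
  qed (simp_all add: W_add_left W_add_right)
qed (simp_all add: W_add_left W_add_right)

lemma W_M_right: "W p (M c q) = c *s W p q"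
  using W_anti[of "M c q" p] W_anti[of q p] by (simp add: W_M_left vec_eq_iff)

lemma W_self: "W p p = 0"
  using W_anti[of p p] by (simp add: vec_eq_iff)

lemma D_derivation: "D d (L p q) = L (D d p) q + L p (D d q)"
proof (induction p rule: poly_mapping_additive_induct)
  case (single r x)
  show ?case
    by (induction q rule: poly_mapping_additive_induct)
      (simp_all add: L_add_right D_add L_single D_single bracket_scal algebra_simps
        sum.distrib scale_left_distrib single_add)
qed (simp_all add: L_add_left D_add algebra_simps)

lemma D_commute: "D d (D d' p) = D d' (D d p)"
  by (induction p rule: poly_mapping_additive_induct) (simp_all add: D_add D_single mult.commute)

lemma D_vec_add: "D (d + d') p = D d p + D d' p"
  by (induction p rule: poly_mapping_additive_induct)
    (simp_all add: D_add D_single distrib_right sum.distrib scale_left_distrib single_add algebra_simps)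

lemma D_vec_scale: "D (c *s d) p = M c (D d p)"
  by (induction p rule: poly_mapping_additive_induct)
    (simp_all add: D_add D_single M_add M_single sum_distrib_left mult.assoc)

lemma W_D: "W (D d p) q + W p (D d q) = 0"
proof (induction p rule: poly_mapping_additive_induct)
  case (single r x)
  show ?case
  proof (induction q rule: poly_mapping_additive_induct)
    case (single s y)
    have "s = - r" if "r + s = 0" using that by (simp add: eq_neg_iff_add_eq_0 add.commute)
    then show ?case
      by (auto simp: W_single D_single form_scal vec_eq_iff sum_negf)
  next
    case (add p q)
    then show ?case by (simp add: W_add_right D_add) (metis (no_types) add.commute add.left_commute add_0)
  qed simp
next
  case (add p p')
  then show ?case by (simp add: W_add_left D_add) (metis (no_types) add.commute add.left_commute add_0)
qed simp

lemma L_jacobi: "L p (L q w) + L q (L w p) + L w (L p q) = 0"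
proof (induction p rule: poly_mapping_additive_induct)
  case (single r x)
  show ?case
  proof (induction q rule: poly_mapping_additive_induct)
    case (single s y)
    show ?case
    proof (induction w rule: poly_mapping_additive_induct)
      case (single t z)
      have "r + (s + t) = r + s + t" "s + (t + r) = r + s + t" "t + (r + s) = r + s + t"
        by (simp_all add: ac_simps)
      then show ?case by (simp only: L_single jacobi single_zero flip: single_add)
    next
      case (add p p')
      from sum3_eq_0[OF add.IH] show ?case by (simp only: L_add_left L_add_right)
    qed simp
  next
    case (add p p')
    from sum3_eq_0[OF add.IH] show ?case by (simp only: L_add_left L_add_right)
  qed simp
next
  case (add p p')
  from sum3_eq_0[OF add.IH] show ?case by (simp only: L_add_left L_add_right)
qed simp

lemma W_jacobi: "W p (L q w) + W q (L w p) + W w (L p q) = 0"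
proof (induction p rule: poly_mapping_additive_induct)
  case (single r x)
  show ?case
  proof (induction q rule: poly_mapping_additive_induct)
    case (single s y)
    show ?case
    proof (induction w rule: poly_mapping_additive_induct)
      case (single t z)
      have e: "r + (s + t) = r + s + t" "s + (t + r) = r + s + t" "t + (r + s) = r + s + t"
        by (simp_all add: ac_simps)
      have f: "form y (bracket z x) = form x (bracket y z)" "form z (bracket x y) = form x (bracket y z)"
        using form_cyclic by metis+
      have "of_int (r $ i) + of_int (s $ i) + of_int (t $ i) = (0 :: complex)" if "r + s + t = 0" for i
        using that by (metis of_int_0 of_int_add vector_add_component zero_index)
      then have "c * of_int (r $ i) + c * of_int (s $ i) + c * of_int (t $ i) = 0"
        if "r + s + t = 0" for i and c :: complex
        using that by (metis distrib_left mult_zero_right)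
      then show ?case by (simp add: L_single W_single e f vec_eq_iff)
    next
      case (add p p')
      from sum3_eq_0[OF add.IH] show ?case by (simp only: L_add_left L_add_right W_add_left W_add_right)
    qed simp
  next
    case (add p p')
    from sum3_eq_0[OF add.IH] show ?case by (simp only: L_add_left L_add_right W_add_left W_add_right)
  qed simp
next
  case (add p p')
  from sum3_eq_0[OF add.IH] show ?case by (simp only: L_add_left L_add_right W_add_left W_add_right)
qed simp

lemma vector_space_toroidal:
  "vector_space (toroidal_scale scal :: complex \<Rightarrow> ('g, 'n::finite) toroidal \<Rightarrow> _)"
  by unfold_locales
    (auto simp: toroidal_scale_def M_add vector_add_ldistrib vector_sadd_rdistrib vector_smult_assoc
      intro!: poly_mapping_eqI simp: M_lookup lookup_add scale_left_distrib)

lemma complex_lie_algebra_toroidal: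
  "complex_lie_algebra (toroidal_scale scal :: complex \<Rightarrow> ('g, 'n::finite) toroidal \<Rightarrow> _)
     (toroidal_bracket scal bracket form)"
proof (intro complex_lie_algebra.intro complex_lie_algebra_axioms.intro vector_space_toroidal)
  note lin = vector_space_linear_iff[OF vector_space_toroidal vector_space_toroidal]
  fix x y z :: "('g, 'n) toroidal"
  show "Vector_Spaces.linear (toroidal_scale scal) (toroidal_scale scal)
      (\<lambda>x. toroidal_bracket scal bracket form x y)"
    unfolding lin by (cases y)
      (auto simp: toroidal_bracket_def toroidal_scale_def L_add_left W_add_left D_add D_vec_add
        L_M_left W_M_left D_M D_vec_scale M_add M_diff algebra_simps)
  show "Vector_Spaces.linear (toroidal_scale scal) (toroidal_scale scal)
      (\<lambda>y. toroidal_bracket scal bracket form x y)"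
    unfolding lin by (cases x)
      (auto simp: toroidal_bracket_def toroidal_scale_def L_add_right W_add_right D_add D_vec_add
        L_M_right W_M_right D_M D_vec_scale M_add M_diff algebra_simps)
  show "toroidal_bracket scal bracket form x x = 0"
    by (cases x) (simp add: toroidal_bracket_def L_self W_self zero_prod_def)
  obtain p k d where x: "x = (p, k, d)" by (cases x)
  obtain q k' d' where y: "y = (q, k', d')" by (cases y)
  obtain w k'' d'' where z: "z = (w, k'', d'')" by (cases z)
  have D0: "D 0 u = 0" for u :: "(int ^ 'n) \<Rightarrow>\<^sub>0 'g"
    using D_vec_add[of 0 0 u] by simp
  have wd: "W u (D e v) = - W (D e u) v" for u v :: "(int ^ 'n) \<Rightarrow>\<^sub>0 'g" and e
    using W_D[of e u v] by (simp add: eq_neg_iff_add_eq_0 add.commute)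
  have "L p (L q w + D d' w - D d'' q) + D d (L q w + D d' w - D d'' q) +
        (L q (L w p + D d'' p - D d w) + D d' (L w p + D d'' p - D d w)) +
        (L w (L p q + D d q - D d' p) + D d'' (L p q + D d q - D d' p)) = 0"
    using L_jacobi[of p q w] L_anti[of "D d q" w] L_anti[of "D d' w" p] L_anti[of "D d'' p" q]
      L_anti[of "D d w" q] L_anti[of "D d' p" w] L_anti[of "D d'' q" p]
    by (simp add: L_add_right L_diff D_add D_diff D_derivation D_commute[of d'' d]
        D_commute[of d'' d'] D_commute[of d' d] algebra_simps)
  moreover have "W p (L q w + D d' w - D d'' q) + W q (L w p + D d'' p - D d w) +
        W w (L p q + D d q - D d' p) = 0"
    using W_jacobi[of p q w] W_anti[of "D d q" w] W_anti[of "D d' w" p] W_anti[of "D d'' p" q]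
      wd[of q d w] wd[of w d' p] wd[of p d'' q]
      W_anti[of "D d w" q] W_anti[of "D d' p" w] W_anti[of "D d'' q" p]
    by (simp add: W_add_right W_diff algebra_simps)
  ultimately show "toroidal_bracket scal bracket form x (toroidal_bracket scal bracket form y z) +
      toroidal_bracket scal bracket form y (toroidal_bracket scal bracket form z x) +
      toroidal_bracket scal bracket form z (toroidal_bracket scal bracket form x y) = 0"
    by (simp add: x y z toroidal_bracket_def D0 zero_prod_def add.assoc)
qed

lemma toroidal_bracket_loop_loop:
  fixes r s :: "int ^ 'n::finite"
  shows "toroidal_bracket scal bracket form (loop_elt X r) (loop_elt Y s) =
     loop_elt (bracket X Y) (r + s) +
     (\<Sum>i\<in>UNIV. toroidal_scale scal (if r + s = 0 then form X Y * of_int (r $ i) else 0) (central_elt i))"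
proof -
  have "(\<Sum>i\<in>UNIV. toroidal_scale scal (c i) (central_elt i)) = (0, (\<chi> i. c i), 0)" for c :: "'n \<Rightarrow> complex"
  proof -
    have "(\<Sum>i\<in>S. toroidal_scale scal (c i) (central_elt i)) = (0, (\<Sum>i\<in>S. c i *s axis i 1), 0)" if "finite S" for S
      using that by (induction S rule: finite_induct)
        (simp_all add: toroidal_scale_def central_elt_def zero_prod_def)
    moreover have "(\<Sum>i\<in>UNIV. c i *s axis i 1) = (\<chi> i. c i)"
      by (simp add: vec_eq_iff axis_def if_distrib cong: if_cong)
    ultimately show ?thesis by simp
  qed
  then show ?thesis
    by (simp add: toroidal_bracket_def loop_elt_def L_single W_single loop_derivation_def)
      (simp add: vec_eq_iff)
qed

lemma toroidal_bracket_central: "toroidal_bracket scal bracket form (central_elt i) x = 0"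
  using D_vec_add[of 0 0]
  by (cases x) (simp add: toroidal_bracket_def central_elt_def zero_prod_def)

lemma toroidal_bracket_degree_loop:
  "toroidal_bracket scal bracket form (degree_derivation i) (loop_elt X r) =
     toroidal_scale scal (of_int (r $ i)) (loop_elt X r)"
proof -
  have "(\<Sum>j\<in>UNIV. axis i 1 $ j * of_int (r $ j)) = (of_int (r $ i) :: complex)"
    by (simp add: axis_def if_distrib if_distribR cong: if_cong)
  then show ?thesis
    using D_vec_add[of 0 0]
    by (simp add: toroidal_bracket_def degree_derivation_def loop_elt_def toroidal_scale_def
        D_single M_single)
qed

lemma toroidal_bracket_degree_degree:
  "toroidal_bracket scal bracket form (degree_derivation i) (degree_derivation j) = 0"
  by (simp add: toroidal_bracket_def degree_derivation_def zero_prod_def)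

end

definition is_direct_sum :: "'v::comm_monoid_add set set \<Rightarrow> bool" where
  "is_direct_sum F \<longleftrightarrow>
     (\<forall>v. \<exists>!f. (\<forall>S\<in>F. f S \<in> S) \<and> (\<forall>S. S \<notin> F \<longrightarrow> f S = 0) \<and>
               finite {S. f S \<noteq> 0} \<and> v = (\<Sum>S | f S \<noteq> 0. f S))"

locale lie_module = complex_lie_algebra scal bracket + V: vector_space scaleV
  for scal :: "complex \<Rightarrow> 'a::ab_group_add \<Rightarrow> 'a" and bracket
    and scaleV :: "complex \<Rightarrow> 'v::ab_group_add \<Rightarrow> 'v" +
  fixes act :: "'a \<Rightarrow> 'v \<Rightarrow> 'v"
  assumes linear_act_left: "Vector_Spaces.linear scal scaleV (\<lambda>x. act x v)"
    and linear_act_right: "Vector_Spaces.linear scaleV scaleV (act x)"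
    and act_bracket: "act (bracket x y) v = act x (act y v) - act y (act x v)"
begin

definition submodule :: "'v set \<Rightarrow> bool" where
  "submodule W \<longleftrightarrow> V.subspace W \<and> (\<forall>x. \<forall>w\<in>W. act x w \<in> W)"

definition generated_by :: "'v \<Rightarrow> bool" where
  "generated_by v \<longleftrightarrow> submodule hull {v} = UNIV"

text \<open>
  For a subspace \<open>T\<close>, only the restriction of \<open>\<mu>\<close> to \<open>T\<close> matters, and it is automatically linear
  when the weight space is nonzero. Hence the direct sum below is taken over the set of weight
  spaces and not over the functions \<open>\<mu>\<close>.
\<close>

definition weight_space :: "'a set \<Rightarrow> ('a \<Rightarrow> complex) \<Rightarrow> 'v set" where
  "weight_space T \<mu> = {v. \<forall>x\<in>T. act x v = scaleV (\<mu> x) v}"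

definition weight_vector :: "'a set \<Rightarrow> 'v \<Rightarrow> bool" where
  "weight_vector T v \<longleftrightarrow> v \<noteq> 0 \<and> (\<exists>\<mu>. v \<in> weight_space T \<mu>)"

definition weight_module :: "'a set \<Rightarrow> bool" where
  "weight_module T \<longleftrightarrow> is_direct_sum (range (weight_space T))"

definition finite_dim_weight_spaces :: "'a set \<Rightarrow> bool" where
  "finite_dim_weight_spaces T \<longleftrightarrow> (\<forall>\<mu>. \<exists>B. finite B \<and> V.span B = weight_space T \<mu>)"

end

end

(*
  Some h in the Cartan subalgebra satisfies (h,h) \<noteq> 0, and the operators h(r) form a Heisenberg
  algebra with [h(r), h(-r)] = (h,h) \<Sum> r_i k_i, shifting weights by r. The operators h(-r)h(r)
  commute, so they have a common eigenvector v in a weight space. Where \<Sum> r_i k_i \<noteq> 0, h(r) or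
  h(-r) does not kill v; for every r in a half plane let S contain r or -r accordingly. For fixed u \<noteq> 0 the
  vectors h(u-r)h(r)v with r, u-r in S have different joint eigenvalues and one common weight, so
  there are finitely many of them. Hence S is almost invariant under translations, and as a half plane
  with a bounded piece removed is connected, the sign is eventually constant, which yields
  infinitely many pairs in S with the same sum.

  That H carries an anisotropic vector needs no root space decomposition of g: H acts diagonally on
  V, and an element of [H, g] acts off-diagonally, so H meets [H, g] trivially; but [H, g] is the
  orthogonal complement of the centraliser of H, which lies in H because H is self-normalising.
*)
theory Submission
  imports Defs "HOL-Computational_Algebra.Fundamental_Theorem_Algebra"
begin

section \<open>Common eigenvectors and separation of vectors by operators\<close>

locale linear_operator = vector_space scale
  for scale :: "'a::field \<Rightarrow> 'b::ab_group_add \<Rightarrow> 'b" +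
  fixes N :: "'b \<Rightarrow> 'b"
  assumes linear_N: "Vector_Spaces.linear scale scale N"
begin

sublocale N: Vector_Spaces.linear scale scale N by (rule linear_N)

text \<open>This is p(N) w by Horner's scheme; working with a fixed vector avoids forming an algebra
  of endomorphisms.\<close>

definition operator_poly :: "'a poly \<Rightarrow> 'b \<Rightarrow> 'b" where
  "operator_poly p w = fold_coeffs (\<lambda>c u. scale c w + N u) p 0"

lemma operator_poly_0 [simp]: "operator_poly 0 w = 0"
  by (simp add: operator_poly_def)

lemma operator_poly_pCons: "operator_poly (pCons c p) w = scale c w + N (operator_poly p w)"
  by (cases "c = 0"; cases "p = 0") (simp_all add: operator_poly_def N.zero)

lemma operator_poly_add: "operator_poly (p + q) w = operator_poly p w + operator_poly q w"
  by (induction p q rule: poly_induct2)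
    (simp_all add: operator_poly_pCons N.add scale_left_distrib algebra_simps)

lemma operator_poly_smult: "operator_poly (smult c p) w = scale c (operator_poly p w)"
  by (induction p) (simp_all add: operator_poly_pCons N.scale scale_right_distrib)

lemma operator_poly_sum: "operator_poly (sum f I) w = (\<Sum>i\<in>I. operator_poly (f i) w)"
  by (induction I rule: infinite_finite_induct) (simp_all add: operator_poly_add)

lemma operator_poly_monom: "operator_poly (monom c i) w = scale c ((N ^^ i) w)"
  by (induction i) (simp_all add: monom_0 monom_Suc operator_poly_pCons N.zero N.scale)

lemma operator_poly_linear_factor:
  "operator_poly ([:- z, 1:] * q) w = N (operator_poly q w) - scale z (operator_poly q w)"
proof -
  have "[:- z, 1:] * q = smult (- z) q + pCons 0 q" by simp
  then show ?thesis
    by (simp only: operator_poly_add operator_poly_smult operator_poly_pCons) simp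
qed

lemma operator_poly_mem:
  assumes "subspace U" "N ` U \<subseteq> U" "w \<in> U"
  shows "operator_poly p w \<in> U"
  using assms
  by (induction p) (auto simp: operator_poly_pCons subspace_0 intro!: subspace_add subspace_scale)

text \<open>The powers N^i w with i from 0 to \<open>card B\<close> are one vector too many for the
  span of \<open>B\<close>; a linear relation among them is the polynomial.\<close>

lemma annihilating_poly_exists:
  assumes "subspace U" "N ` U \<subseteq> U" "w \<in> U" "finite B" "U \<subseteq> span B"
  obtains p where "p \<noteq> 0" "operator_poly p w = 0"
proof -
  let ?u = "\<lambda>i. (N ^^ i) w" and ?I = "{..card B}"
  have u: "?u i \<in> U" for i
    using assms by (induction i) auto
  show ?thesis
  \<comment> \<open>Dependence is a property of sets and does not see repetitions, so the case N^i w
    = N^j w is treated separately and gives X^i - X^j.\<close>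
  proof (cases "inj_on ?u ?I")
    case True
    have "card (?u ` ?I) = Suc (card B)"
      using card_image[OF True] by simp
    then have "dependent (?u ` ?I)"
      using independent_span_bound[OF assms(4), of "?u ` ?I"] u assms(5) by fastforce
    then obtain c where c: "\<exists>v\<in>?u ` ?I. c v \<noteq> 0" "(\<Sum>v\<in>?u ` ?I. scale (c v) v) = 0"
      by (subst (asm) dependent_finite) auto
    let ?p = "\<Sum>i\<in>?I. monom (c (?u i)) i"
    obtain i where i: "i \<in> ?I" "c (?u i) \<noteq> 0" using c(1) by blast
    have "coeff ?p i = c (?u i)" using i(1) by (simp add: coeff_sum)
    then have "?p \<noteq> 0" using i(2) by auto
    moreover have "operator_poly ?p w = 0"
      using c(2) by (simp add: operator_poly_sum operator_poly_monom sum.reindex[OF True])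
    ultimately show ?thesis by (rule that)
  next
    case False
    then obtain i j where ij: "i \<noteq> j" "?u i = ?u j" by (auto simp: inj_on_def)
    let ?p = "monom 1 i + monom (- 1) j :: 'a poly"
    have "coeff ?p i = 1" using ij(1) by simp
    then have "?p \<noteq> 0" by (metis coeff_0 zero_neq_one)
    moreover have "operator_poly ?p w = 0"
      using ij(2) by (simp add: operator_poly_add operator_poly_monom)
    ultimately show ?thesis by (rule that)
  qed
qed

end

section \<open>Separating operators and common eigenvectors\<close>

context vector_space
begin

text \<open>N - \<beta> kills every other element of \<open>X\<close> and multiplies x by \<alpha> -
  \<beta>, so applied to a linear relation it isolates the coefficient of x.\<close>

lemma independent_if_separating_operators:
  assumes "\<And>x. x \<in> X \<Longrightarrow> x \<noteq> 0"
    and "\<And>x. x \<in> X \<Longrightarrow> \<exists>N \<alpha> \<beta>. Vector_Spaces.linear scale scale N \<and> \<alpha> \<noteq> \<beta> \<and> N x = scale \<alpha> x \<and>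
           (\<forall>y\<in>X - {x}. N y = scale \<beta> y)"
  shows "independent X"
  unfolding independent_explicit_module
proof (intro allI impI)
  fix t u x assume t: "finite t" "t \<subseteq> X" "(\<Sum>v\<in>t. scale (u v) v) = 0" and x: "x \<in> t"
  obtain N \<alpha> \<beta> where N: "Vector_Spaces.linear scale scale N" "\<alpha> \<noteq> \<beta>" "N x = scale \<alpha> x"
      "\<And>y. y \<in> X - {x} \<Longrightarrow> N y = scale \<beta> y"
    using assms(2) t(2) x by blast
  interpret N: Vector_Spaces.linear scale scale N by fact
  have "0 = N (\<Sum>v\<in>t. scale (u v) v) - scale \<beta> (\<Sum>v\<in>t. scale (u v) v)"
    by (simp add: t(3) N.zero)
  also have "\<dots> = (\<Sum>v\<in>t. scale (u v) (N v - scale \<beta> v))"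
    by (simp add: N.sum N.scale scale_sum_right sum_subtractf scale_right_diff_distrib mult.commute)
  also have "\<dots> = (\<Sum>v\<in>t. if v = x then scale (u v) (scale (\<alpha> - \<beta>) v) else 0)"
    using t(2) by (intro sum.cong) (auto simp: N scale_left_diff_distrib)
  also have "\<dots> = scale (u x * (\<alpha> - \<beta>)) x"
    using t(1) x by simp
  finally show "u x = 0" using N(2) assms(1)[of x] t(2) x by auto
qed

end

text \<open>Split a linear factor X - z off a polynomial annihilating w. Either the cofactor q still
  annihilates w and has smaller degree, or q(N) w is an eigenvector for z, and it stays in
  \<open>U\<close> because \<open>U\<close> is stable.\<close>

lemma eigenvector_exists:
  fixes s :: "complex \<Rightarrow> 'v::ab_group_add \<Rightarrow> 'v"
  assumes N: "Vector_Spaces.linear s s N" and U: "module.subspace s U" "N ` U \<subseteq> U" "U \<noteq> {0}"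
    and B: "finite B" "U \<subseteq> module.span s B"
  obtains z u where "u \<in> U" "u \<noteq> 0" "N u = s z u"
proof -
  interpret linear_operator s N
    using N by (simp add: linear_operator_def linear_operator_axioms_def Vector_Spaces.linear_def)
  obtain w where w: "w \<in> U" "w \<noteq> 0" using U subspace_0 by blast
  have "\<exists>z u. u \<in> U \<and> u \<noteq> 0 \<and> N u = s z u" if "p \<noteq> 0" "operator_poly p w = 0" for p
    using that
  proof (induction "degree p" arbitrary: p rule: less_induct)
    case less
    show ?case
    proof (cases "degree p = 0")
      case True
      then obtain c where "p = [:c:]" by (rule degree_eq_zeroE)
      then show ?thesis using less.prems w by (simp add: operator_poly_pCons N.zero)
    next
      case False
      then obtain z where "poly p z = 0"
        using fundamental_theorem_of_algebra[of p] constant_degree[of p] by auto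
      then obtain q where q: "p = [:- z, 1:] * q" by (auto simp: poly_eq_0_iff_dvd)
      then have "q \<noteq> 0" using less.prems by auto
      then have "degree q < degree p" unfolding q by (subst degree_mult_eq) auto
      show ?thesis
      proof (cases "operator_poly q w = 0")
        case True
        then show ?thesis using less.hyps \<open>q \<noteq> 0\<close> \<open>degree q < degree p\<close> by blast
      next
        case False
        moreover have "operator_poly q w \<in> U" using operator_poly_mem[OF U(1,2)] w by blast
        moreover have "N (operator_poly q w) = s z (operator_poly q w)"
          using less.prems(2) unfolding q operator_poly_linear_factor by simp
        ultimately show ?thesis by blast
      qed
    qed
  qed
  moreover obtain p where "p \<noteq> 0" "operator_poly p w = 0"
    using annihilating_poly_exists[OF U(1,2) w(1) B] by blast
  ultimately show ?thesis using that by blast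
qed

text \<open>On a nonzero stable subspace of least dimension every \<open>N i\<close> is scalar: an
  eigenspace of \<open>N i\<close> in it is stable under all \<open>N j\<close> by commutativity, so
  it is the whole subspace. The argument allows an infinite index set, as needed for a family
  indexed by a lattice.\<close>

lemma common_eigenvector_exists:
  fixes s :: "complex \<Rightarrow> 'v::ab_group_add \<Rightarrow> 'v"
  assumes "vector_space s"
    and N: "\<And>i. i \<in> I \<Longrightarrow> Vector_Spaces.linear s s (N i)"
    and U: "module.subspace s U" "U \<noteq> {0}" "\<And>i. i \<in> I \<Longrightarrow> N i ` U \<subseteq> U"
    and comm: "\<And>i j u. i \<in> I \<Longrightarrow> j \<in> I \<Longrightarrow> u \<in> U \<Longrightarrow> N i (N j u) = N j (N i u)"
    and B: "finite B" "U \<subseteq> module.span s B"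
  obtains u where "u \<in> U" "u \<noteq> 0" "\<And>i. i \<in> I \<Longrightarrow> \<exists>z. N i u = s z u"
proof -
  interpret vector_space s by fact
  define P where "P W \<longleftrightarrow> subspace W \<and> W \<noteq> {0} \<and> W \<subseteq> U \<and> (\<forall>i\<in>I. N i ` W \<subseteq> W)" for W
  have "P U" using U by (auto simp: P_def)
  then obtain W where W: "P W" and min: "\<And>W'. dim W' < dim W \<Longrightarrow> \<not> P W'"
    using ex_has_least_nat[of P U dim] by (metis not_le)
  obtain C where C: "C \<subseteq> W" "independent C" "W \<subseteq> span C" "card C = dim W"
    by (rule basis_exists)
  have "finite C" using independent_span_bound[OF B(1) C(2)] C(1) W B(2) by (auto simp: P_def)
  have W': "subspace W" "W \<noteq> {0}" "W \<subseteq> U" "\<And>i. i \<in> I \<Longrightarrow> N i ` W \<subseteq> W"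
    using W by (auto simp: P_def)
  have scalar: "\<exists>z. \<forall>w\<in>W. N i w = s z w" if i: "i \<in> I" for i
  proof -
    interpret Ni: Vector_Spaces.linear s s "N i" by (rule N[OF i])
    obtain z u where u: "u \<in> W" "u \<noteq> 0" "N i u = s z u"
      using eigenvector_exists[OF N[OF i] W'(1) W'(4)[OF i] W'(2) \<open>finite C\<close> C(3)] by blast
    define E where "E = {w \<in> W. N i w = s z w}"
    have "subspace E"
      using W'(1) by (auto simp: E_def subspace_def Ni.add Ni.scale Ni.zero scale_right_distrib mult.commute)
    moreover have "N j ` E \<subseteq> E" if j: "j \<in> I" for j
    proof -
      interpret Nj: Vector_Spaces.linear s s "N j" by (rule N[OF j])
      show ?thesis using W'(3) W'(4)[OF j] comm[OF i j] by (auto simp: E_def Nj.scale subset_iff)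
    qed
    ultimately have "P E" using u W' by (auto simp: P_def E_def)
    have "W \<subseteq> E"
    proof (rule ccontr)
      assume "\<not> W \<subseteq> E"
      then obtain w where w: "w \<in> W" "w \<notin> E" by blast
      obtain D where D: "D \<subseteq> E" "independent D" "E \<subseteq> span D" "card D = dim E"
        by (rule basis_exists)
      have "w \<notin> span D" using w(2) span_minimal[OF D(1) \<open>subspace E\<close>] by blast
      then have "independent (insert w D)" using D(2) by (rule independent_insertI)
      moreover have "insert w D \<subseteq> span C" using w(1) D(1) C(3) by (auto simp: E_def)
      ultimately have "finite (insert w D)" "card (insert w D) \<le> dim W"
        using independent_span_bound[OF \<open>finite C\<close>, of "insert w D"] C(4) by simp_all
      moreover have "w \<notin> D" using \<open>w \<notin> span D\<close> span_base by blast
      ultimately have "dim E < dim W" using D(4) by simp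
      then show False using min \<open>P E\<close> by blast
    qed
    then show ?thesis by (auto simp: E_def)
  qed
  obtain u where "u \<in> W" "u \<noteq> 0" using W' subspace_0 by blast
  then show ?thesis using that[of u] scalar W'(3) by blast
qed

section \<open>Heisenberg modules graded by a lattice\<close>

text \<open>Beyond a bounded box the sign never changes along unit steps, so a detour around the box
  joins (1, y) to (1, -y) and gives them equal signs for all large y.\<close>

lemma half_plane_sign_contradiction:
  fixes \<sigma> :: "int \<Rightarrow> int \<Rightarrow> bool"
  assumes horizontal: "finite {(x, y). x \<ge> 1 \<and> \<sigma> x y \<noteq> \<sigma> (x + 1) y}"
    and vertical: "finite {(x, y). x \<ge> 1 \<and> \<sigma> x y \<noteq> \<sigma> x (y + 1)}"
    and mirror: "finite {y. \<sigma> 1 y = \<sigma> 1 (- y)}"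
  shows False
proof -
  define F where "F = {(x, y). x \<ge> 1 \<and> \<sigma> x y \<noteq> \<sigma> (x + 1) y} \<union> {(x, y). x \<ge> 1 \<and> \<sigma> x y \<noteq> \<sigma> x (y + 1)}"
  have "finite F" using horizontal vertical by (simp add: F_def)
  then have "bdd_above (fst ` F)" "bdd_above (abs ` snd ` F)" by (simp_all add: bdd_above_finite)
  then obtain b c where bc: "\<And>p. p \<in> F \<Longrightarrow> fst p \<le> b" "\<And>p. p \<in> F \<Longrightarrow> \<bar>snd p\<bar> \<le> c"
    by (auto simp: bdd_above_def)
  \<comment> \<open>\<open>m\<close> exceeds both coordinates of every point where the sign changes,
    and \<open>m \<ge> 1\<close> puts the column x = m in the half plane.\<close>
  define m where "m = max 1 (max (b + 1) (c + 1))"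
  have m: "1 \<le> m" "b < m" "c < m" by (auto simp: m_def)
  have outside: "(x, y) \<notin> F" if "x \<ge> m \<or> \<bar>y\<bar> \<ge> m" for x y
    using bc[of "(x, y)"] m that by auto
  have step: "\<sigma> x y = \<sigma> (x + 1) y" "\<sigma> x y = \<sigma> x (y + 1)" if "x \<ge> 1" "x \<ge> m \<or> \<bar>y\<bar> \<ge> m" for x y
    using outside[OF that(2)] that(1) by (auto simp: F_def)
  have row: "\<sigma> x y = \<sigma> 1 y" if "x \<ge> 1" "\<bar>y\<bar> \<ge> m" for x y
    using that by (induction x rule: int_ge_induct) (simp_all add: step(1)[symmetric])
  have column: "\<sigma> m y = \<sigma> m k" if "y \<ge> k" for y k
    using that by (induction y rule: int_ge_induct) (use m in \<open>simp_all add: step(2)[symmetric]\<close>)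
  \<comment> \<open>The path runs along row y out to the column x = m, down this column to row -y,
    and back in.\<close>
  have "\<sigma> 1 y = \<sigma> 1 (- y)" if "y \<ge> m" for y
    using row[of m y] row[of m "- y"] column[of "- y" y] m that by auto
  then have "{m..} \<subseteq> {y. \<sigma> 1 y = \<sigma> 1 (- y)}" by auto
  then show False using mirror finite_subset infinite_Ici by blast
qed

text \<open>For \<open>c\<close> the vector of central charges this is the scalar by which \<Sum>
  r_i K_i acts. For \<open>c\<close> the d-component of a Cartan element it is the degree by which
  that element scales t^r.\<close>

definition int_pairing :: "complex ^ 'n::finite \<Rightarrow> int ^ 'n \<Rightarrow> complex" where
  "int_pairing c r = (\<Sum>i\<in>UNIV. c $ i * of_int (r $ i))"

lemma int_pairing_add: "int_pairing c (r + s) = int_pairing c r + int_pairing c s"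
  by (simp add: int_pairing_def distrib_left sum.distrib)

lemma int_pairing_scale: "int_pairing c (x *s r) = of_int x * int_pairing c r"
  by (simp add: int_pairing_def sum_distrib_left algebra_simps)

lemma int_pairing_uminus: "int_pairing c (- r) = - int_pairing c r"
  by (simp add: int_pairing_def sum_negf)

lemma int_pairing_axis: "int_pairing c (axis i 1) = c $ i"
  by (simp add: int_pairing_def axis_def if_distrib cong: if_cong)

text \<open>If the pairing kills a nonzero lattice vector f, that vector is taken as the
  y-direction, so the pairing depends on x alone. Otherwise the pairing vanishes only at 0 and any
  two independent lattice vectors serve.\<close>

lemma half_plane_avoiding_kernel_exists:
  fixes c :: "complex ^ 'n::finite"
  assumes "CARD('n) \<ge> 2" "c \<noteq> 0"
  obtains p :: "int \<Rightarrow> int \<Rightarrow> int ^ 'n" where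
    "\<And>x y x' y'. p x y + p x' y' = p (x + x') (y + y')"
    "\<And>x y. p x y = 0 \<longleftrightarrow> x = 0 \<and> y = 0"
    "\<And>x y. x \<ge> 1 \<Longrightarrow> int_pairing c (p x y) \<noteq> 0"
proof -
  note half_plane = that
  have *: thesis if ef: "\<And>x y. x *s e + y *s f = 0 \<longleftrightarrow> x = 0 \<and> y = 0"
    "\<And>x y. x \<ge> 1 \<Longrightarrow> int_pairing c (x *s e + y *s f) \<noteq> 0" for e f :: "int ^ 'n"
    by (rule half_plane[of "\<lambda>x y. x *s e + y *s f"]) (use ef in \<open>auto simp: vector_sadd_rdistrib\<close>)
  obtain i where i: "c $ i \<noteq> 0" using assms(2) by (auto simp: vec_eq_iff)
  show thesis
  proof (cases "\<exists>f. f \<noteq> 0 \<and> int_pairing c f = 0")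
    case True
    then obtain f where f: "f \<noteq> 0" "int_pairing c f = 0" by blast
    have pairing: "int_pairing c (x *s axis i 1 + y *s f) = of_int x * c $ i" for x y
      by (simp add: int_pairing_add int_pairing_scale int_pairing_axis f)
    show thesis
    proof (rule *)
      fix x y
      show "x *s axis i 1 + y *s f = 0 \<longleftrightarrow> x = 0 \<and> y = 0"
      proof
        assume eq: "x *s axis i 1 + y *s f = 0"
        moreover have "int_pairing c 0 = 0" by (simp add: int_pairing_def)
        ultimately have "x = 0" using pairing[of x y] i by simp
        with eq show "x = 0 \<and> y = 0" using f(1) by (auto simp: vec_eq_iff)
      qed simp
    qed (use pairing i in auto)
  next
    case False
    \<comment> \<open>The second direction is another coordinate axis, which exists as n \<ge>
      2.\<close>
    have "\<exists>j. j \<noteq> i"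
    proof (rule ccontr)
      assume "\<not> ?thesis"
      then have "(UNIV :: 'n set) = {i}" by auto
      then have "CARD('n) = 1" by (metis card.empty card.insert empty_iff finite.emptyI One_nat_def)
      then show False using assms(1) by simp
    qed
    then obtain j where j: "j \<noteq> i" by blast
    have ne: "x *s axis i 1 + y *s axis j 1 = (0 :: int ^ 'n) \<longleftrightarrow> x = 0 \<and> y = 0" for x y
    proof
      assume "x *s axis i 1 + y *s axis j 1 = (0 :: int ^ 'n)"
      then have "(x *s axis i 1 + y *s axis j 1) $ k = (0 :: int)" for k by simp
      from this[of i] this[of j] show "x = 0 \<and> y = 0" using j by (simp add: axis_def)
    qed simp
    show thesis
    proof (rule *)
      fix x y :: int assume "x \<ge> 1"
      then show "int_pairing c (x *s axis i 1 + y *s axis j 1) \<noteq> 0"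
        using False ne by (metis not_one_le_zero)
    qed (rule ne)
  qed
qed

text \<open>This abstracts the operators h(r) for one fixed h: \<open>c\<close> becomes (h,h) times
  the central charges, and \<open>Wt t\<close> the weight space reached from a fixed weight by a
  shift of degree t.\<close>

locale heisenberg_module = vector_space s
  for s :: "complex \<Rightarrow> 'v::ab_group_add \<Rightarrow> 'v" +
  fixes a :: "int ^ 'n::finite \<Rightarrow> 'v \<Rightarrow> 'v"
    and c :: "complex ^ 'n"
    and Wt :: "int ^ 'n \<Rightarrow> 'v set"
  assumes linear_a: "Vector_Spaces.linear s s (a r)"
    and commutator: "a r (a t v) - a t (a r v) = (if r + t = 0 then s (int_pairing c r) v else 0)"
    and subspace_Wt: "module.subspace s (Wt t)"
    and finite_dim_Wt: "\<exists>B. finite B \<and> Wt t \<subseteq> module.span s B"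
    and a_Wt: "v \<in> Wt t \<Longrightarrow> a r v \<in> Wt (t + r)"
begin

section \<open>Number operators and their ladder relations\<close>

lemma a_scale: "a r (s z v) = s z (a r v)"
  and a_zero [simp]: "a r 0 = 0"
proof -
  interpret Vector_Spaces.linear s s "a r" by (rule linear_a)
  show "a r (s z v) = s z (a r v)" "a r 0 = 0" by (simp_all add: scale zero)
qed

lemma a_commute: "r + t \<noteq> 0 \<Longrightarrow> a r (a t v) = a t (a r v)"
  using commutator[of r t v] by simp

definition number_op :: "int ^ 'n \<Rightarrow> 'v \<Rightarrow> 'v" where
  "number_op r v = a (- r) (a r v)"

lemma linear_number_op: "Vector_Spaces.linear s s (number_op r)"
  using Vector_Spaces.linear_compose[OF linear_a[of r] linear_a[of "- r"]]
  by (simp add: number_op_def[abs_def] o_def)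

lemma number_op_Wt: "v \<in> Wt t \<Longrightarrow> number_op r v \<in> Wt t"
  using a_Wt[of "a r v" "t + r" "- r"] a_Wt[of v t r] by (simp add: number_op_def)

lemma number_op_a_other: "t \<noteq> r \<Longrightarrow> t \<noteq> - r \<Longrightarrow> number_op r (a t v) = a t (number_op r v)"
  using a_commute[of r t] a_commute[of "- r" t]
  by (simp add: number_op_def) (metis add.inverse_inverse add_eq_0_iff2 eq_neg_iff_add_eq_0)

lemma number_op_a_same: "number_op r (a r v) = a r (number_op r v) - s (int_pairing c r) (a r v)"
  using commutator[of "- r" r "a r v"]
  by (simp add: number_op_def int_pairing_uminus algebra_simps)

text \<open>This is what allows a choice of sign: if \<open>number_op r\<close> kills v \<noteq> 0
  and r pairs nontrivially with \<open>c\<close>, then \<open>number_op (- r)\<close> does not kill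
  v.\<close>

lemma number_op_uminus: "number_op (- r) v = number_op r v + s (int_pairing c r) v"
  using commutator[of r "- r" v] by (simp add: number_op_def algebra_simps)

text \<open>Outside t = r and t = -r, \<open>number_op r\<close> passes both factors of
  \<open>number_op t\<close>; in the exceptional cases the two operators differ at most by a
  scalar.\<close>

lemma number_op_commute: "number_op r (number_op t v) = number_op t (number_op r v)"
proof (cases "t = r \<or> t = - r")
  case True
  interpret Vector_Spaces.linear s s "number_op r" by (rule linear_number_op)
  show ?thesis using True by (auto simp: number_op_uminus add scale)
next
  case False
  then have "- t \<noteq> r" "- t \<noteq> - r" by auto
  with False show ?thesis by (simp add: number_op_def[of t] number_op_a_other)
qed

text \<open>The vectors a (u - r) (a r v) all lie in the finite dimensional
  \<open>Wt (t + u)\<close>. Applying a r shifts the eigenvalue of \<open>number_op r\<close>, so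
  this operator tells the vector of the pair {r, u - r} from those of all other pairs.\<close>

lemma finite_raising_pairs:
  assumes v: "v \<in> Wt t" and eigen: "\<And>r. \<exists>z. number_op r v = s z v"
    and S: "\<And>r. r \<in> S \<Longrightarrow> int_pairing c r \<noteq> 0 \<and> number_op r v \<noteq> 0 \<and> - r \<notin> S"
    and "u \<noteq> 0"
  shows "finite {r \<in> S. u - r \<in> S \<and> r \<noteq> u - r}"
proof -
  define F where "F = {r \<in> S. u - r \<in> S \<and> r \<noteq> u - r}"
  define w where "w r = a (u - r) (a r v)" for r
  obtain \<mu> where eig: "number_op r v = s (\<mu> r) v" for r using eigen by metis
  have neg: "u - r \<noteq> - r" "r \<noteq> - (u - r)" for r using \<open>u \<noteq> 0\<close> by auto
  have own: "number_op r (w r) = s (\<mu> r - int_pairing c r) (w r)" if "r \<in> F" for r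
  proof -
    have "number_op r (w r) = a (u - r) (number_op r (a r v))"
      unfolding w_def by (rule number_op_a_other) (use that neg in \<open>auto simp: F_def\<close>)
    also have "number_op r (a r v) = s (\<mu> r - int_pairing c r) (a r v)"
      by (simp add: number_op_a_same eig a_scale scale_left_diff_distrib)
    finally show ?thesis by (simp add: a_scale w_def)
  qed
  have other: "number_op r (w q) = s (\<mu> r) (w q)" if "r \<in> F" "q \<in> F" "q \<noteq> r" "q \<noteq> u - r" for r q
  proof -
    \<comment> \<open>Both q and u - q lie in \<open>S\<close> while -r does not, so neither raising
      operator involves the mode of r or -r.\<close>
    have "q \<noteq> - r" "u - q \<noteq> - r" "u - q \<noteq> r"
      using that S[of r] by (auto simp: F_def)
    then show ?thesis
      using that by (simp add: w_def number_op_a_other eig a_scale)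
  qed
  have nonzero: "w r \<noteq> 0" if r: "r \<in> F" for r
  proof
    assume "w r = 0"
    \<comment> \<open>Lowering by u - r and then by r turns w r into \<mu>(u - r) \<mu>(r) v, and
      both factors are nonzero because r and u - r lie in \<open>S\<close>.\<close>
    then have "a (- r) (number_op (u - r) (a r v)) = 0"
      by (simp add: number_op_def w_def)
    moreover have "number_op (u - r) (a r v) = a r (number_op (u - r) v)"
      by (rule number_op_a_other) (use r neg in \<open>auto simp: F_def\<close>)
    ultimately have "s (\<mu> (u - r)) (number_op r v) = 0"
      by (simp only: eig a_scale flip: number_op_def)
    then show False using S[of r] S[of "u - r"] r by (auto simp: eig F_def)
  qed
  have "independent (w ` F)"
  proof (rule independent_if_separating_operators)
    fix x assume "x \<in> w ` F"
    then obtain r where r: "r \<in> F" "x = w r" by blast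
    have "number_op r y = s (\<mu> r) y" if "y \<in> w ` F - {x}" for y
    proof -
      from that obtain q where q: "q \<in> F" "y = w q" by blast
      have "w q \<noteq> w r" using that q(2) r(2) by simp
      moreover have "w (u - r) = w r" using a_commute[of r "u - r" v] \<open>u \<noteq> 0\<close> by (simp add: w_def)
      ultimately have "q \<noteq> r" "q \<noteq> u - r" by auto
      then show ?thesis using other[OF r(1) q(1)] q(2) by simp
    qed
    moreover have "\<mu> r - int_pairing c r \<noteq> \<mu> r" using S r by (auto simp: F_def)
    ultimately show "\<exists>N \<alpha> \<beta>. Vector_Spaces.linear s s N \<and> \<alpha> \<noteq> \<beta> \<and> N x = s \<alpha> x \<and>
        (\<forall>y\<in>w ` F - {x}. N y = s \<beta> y)"
      using linear_number_op own[OF r(1)] r(2)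
      by (intro exI[of _ "number_op r"] exI[of _ "\<mu> r - int_pairing c r"] exI[of _ "\<mu> r"] conjI ballI) simp_all
  qed (use nonzero in auto)
  moreover have "w ` F \<subseteq> Wt (t + u)"
  proof
    fix x assume "x \<in> w ` F"
    then obtain r where "x = w r" by blast
    moreover have "a (u - r) (a r v) \<in> Wt (t + r + (u - r))" by (intro a_Wt v)
    ultimately show "x \<in> Wt (t + u)" by (simp add: w_def)
  qed
  ultimately have "finite (w ` F)"
    using finite_dim_Wt[of "t + u"] independent_span_bound by (meson subset_trans)
  \<comment> \<open>Passing from finitely many vectors to finitely many r: r and u - r give the same
    vector, and no third index does, since \<open>number_op r\<close> would then have two
    eigenvalues on it.\<close>
  moreover have "finite {q \<in> F. w q = y}" for y
  proof (cases "\<exists>r\<in>F. w r = y")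
    case True
    then obtain r where r: "r \<in> F" "w r = y" by blast
    have "q = r \<or> q = u - r" if "q \<in> F" "w q = y" for q
    proof (rule ccontr)
      assume "\<not> ?thesis"
      then have "s (int_pairing c r) (w r) = 0"
        using other[OF r(1) that(1)] own[OF r(1)] that(2) r(2) by (simp add: scale_left_diff_distrib)
      then show False using nonzero[OF r(1)] S[of r] r(1) by (auto simp: F_def)
    qed
    then have "{q \<in> F. w q = y} \<subseteq> {r, u - r}" by auto
    then show ?thesis by (rule finite_subset) simp
  next
    case False
    then have "{q \<in> F. w q = y} = {}" by blast
    then show ?thesis by (simp only: finite.emptyI)
  qed
  ultimately have "finite (\<Union>y\<in>w ` F. {q \<in> F. w q = y})" by blast
  then have "finite F" by (rule rev_finite_subset) auto
  then show ?thesis by (simp add: F_def)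
qed

text \<open>A nonzero \<open>Wt t\<close> contains a common eigenvector of all number operators.
  Whether \<open>number_op r\<close> kills it is a sign on a half plane, to which
  \<open>half_plane_sign_contradiction\<close> applies.\<close>

theorem Wt_trivial:
  assumes "CARD('n) \<ge> 2" "c \<noteq> 0"
  shows "Wt t = {0}"
proof (rule ccontr)
  assume "Wt t \<noteq> {0}"
  obtain B where B: "finite B" "Wt t \<subseteq> span B" using finite_dim_Wt by blast
  obtain v where v: "v \<in> Wt t" "v \<noteq> 0" "\<And>r. \<exists>z. number_op r v = s z v"
  proof (rule common_eigenvector_exists[of s UNIV number_op "Wt t" B])
    show "number_op r ` Wt t \<subseteq> Wt t" for r using number_op_Wt by blast
  qed (use vector_space_axioms linear_number_op subspace_Wt \<open>Wt t \<noteq> {0}\<close> number_op_commute B in auto)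
  obtain p :: "int \<Rightarrow> int \<Rightarrow> int ^ 'n" where
    p_add: "\<And>x y x' y'. p x y + p x' y' = p (x + x') (y + y')"
    and p_0: "\<And>x y. p x y = 0 \<longleftrightarrow> x = 0 \<and> y = 0"
    and p_c: "\<And>x y. x \<ge> 1 \<Longrightarrow> int_pairing c (p x y) \<noteq> 0"
    using half_plane_avoiding_kernel_exists[OF assms] by metis
  have p_neg: "p (- x) (- y) = - p x y" for x y
    using p_add[of "- x" "- y" x y] p_0[of 0 0] by (simp add: eq_neg_iff_add_eq_0)
  have p_diff: "p x y - p x' y' = p (x - x') (y - y')" for x y x' y'
    using p_add[of x y "- x'" "- y'"] by (simp add: p_neg)
  have p_eq: "p x y = p x' y' \<longleftrightarrow> x = x' \<and> y = y'" for x y x' y'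
    using p_0[of "x - x'" "y - y'"] p_diff[of x y x' y'] by auto
  define \<sigma> where "\<sigma> x y \<longleftrightarrow> number_op (p x y) v \<noteq> 0" for x y
  \<comment> \<open>\<open>S\<close> contains exactly one of \<open>p x y\<close>, \<open>- p x y\<close>, so a change of sign between \<open>q\<close> and \<open>q + u\<close>
      puts one of the two points and the negative of the other in \<open>S\<close>, with sum \<open>\<plusminus>u\<close>.\<close>
  define S where "S = {p x y | x y. x \<ge> 1 \<and> \<sigma> x y} \<union> {p (- x) (- y) | x y. x \<ge> 1 \<and> \<not> \<sigma> x y}"
  have pos: "p x y \<in> S \<longleftrightarrow> \<sigma> x y" "- p x y \<in> S \<longleftrightarrow> \<not> \<sigma> x y" if "x \<ge> 1" for x y
    using that unfolding S_def by (auto simp: p_eq p_neg[symmetric])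
  have S: "int_pairing c r \<noteq> 0 \<and> number_op r v \<noteq> 0 \<and> - r \<notin> S" if "r \<in> S" for r
  proof -
    from that consider x y where "r = p x y" "x \<ge> 1" "\<sigma> x y" | x y where "r = - p x y" "x \<ge> 1" "\<not> \<sigma> x y"
      unfolding S_def p_neg by blast
    then show ?thesis
    proof cases
      case 1
      then show ?thesis using p_c pos by (simp add: \<sigma>_def)
    next
      case 2
      then show ?thesis using p_c[of x y] pos v(2) by (simp add: \<sigma>_def int_pairing_uminus number_op_uminus)
    qed
  qed
  have fin: "finite {r \<in> S. u - r \<in> S \<and> r \<noteq> u - r}" if "u \<noteq> 0" for u
    by (rule finite_raising_pairs[OF v(1) v(3) S that])
  have inj: "inj_on (\<lambda>(x, y). p x y) X" for X by (auto simp: inj_on_def p_eq)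
  \<comment> \<open>The steps (1, 0) and (0, 1) are treated together; \<open>k \<ge> 0\<close> keeps
    the shifted point in the half plane.\<close>
  have step: "finite {(x, y). x \<ge> 1 \<and> \<sigma> x y \<noteq> \<sigma> (x + k) (y + l)}"
    if kl: "k \<ge> 0" "(k, l) \<noteq> (0, 0)" for k l
  proof -
    have "finite {(x, y). x \<ge> 1 \<and> \<sigma> x y \<and> \<not> \<sigma> (x + k) (y + l)}" (is "finite ?X")
    proof (rule inj_on_finite[OF inj])
      show "(\<lambda>(x, y). p x y) ` ?X \<subseteq> {r \<in> S. p (- k) (- l) - r \<in> S \<and> r \<noteq> p (- k) (- l) - r}"
      proof clarify
        fix x y assume *: "1 \<le> x" "\<sigma> x y" "\<not> \<sigma> (x + k) (y + l)"
        have "p (- k) (- l) - p x y = - p (x + k) (y + l)"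
          by (simp add: p_diff p_neg[symmetric] algebra_simps)
        moreover have "p x y \<noteq> - p (x + k) (y + l)" using * kl by (simp add: p_neg[symmetric] p_eq)
        ultimately show "p x y \<in> S \<and> p (- k) (- l) - p x y \<in> S \<and> p x y \<noteq> p (- k) (- l) - p x y"
          using * kl pos[of x y] pos[of "x + k" "y + l"] by simp
      qed
    qed (use fin kl p_0 in simp)
    moreover have "finite {(x, y). x \<ge> 1 \<and> \<not> \<sigma> x y \<and> \<sigma> (x + k) (y + l)}" (is "finite ?Y")
    proof (rule inj_on_finite)
      show "inj_on (\<lambda>(x, y). - p x y) ?Y" by (auto simp: inj_on_def p_eq)
      show "(\<lambda>(x, y). - p x y) ` ?Y \<subseteq> {r \<in> S. p k l - r \<in> S \<and> r \<noteq> p k l - r}"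
      proof clarify
        fix x y assume *: "1 \<le> x" "\<not> \<sigma> x y" "\<sigma> (x + k) (y + l)"
        have "p k l - (- p x y) = p (x + k) (y + l)" by (simp add: p_add algebra_simps)
        moreover have "- p x y \<noteq> p (x + k) (y + l)" using * kl by (simp add: p_neg[symmetric] p_eq)
        ultimately show "- p x y \<in> S \<and> p k l - - p x y \<in> S \<and> - p x y \<noteq> p k l - - p x y"
          using * kl pos[of x y] pos[of "x + k" "y + l"] by simp
      qed
    qed (use fin kl p_0 in simp)
    ultimately have "finite (?X \<union> ?Y)" by simp
    then show ?thesis by (rule rev_finite_subset) auto
  qed
  \<comment> \<open>Mirror points of equal sign put p 1 y and p 1 (-y), or both their negatives, in
    \<open>S\<close>, with sum p 2 0 or its negative. The two are distinct for y \<noteq> 0, and y =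
    0 is added back at the end.\<close>
  have "finite {y. y \<noteq> 0 \<and> \<sigma> 1 y \<and> \<sigma> 1 (- y)}" (is "finite ?X")
  proof (rule inj_on_finite)
    show "inj_on (p 1) ?X" by (auto simp: inj_on_def p_eq)
    show "p 1 ` ?X \<subseteq> {r \<in> S. p 2 0 - r \<in> S \<and> r \<noteq> p 2 0 - r}"
    proof clarify
      fix y assume "\<sigma> 1 y" "\<sigma> 1 (- y)" "y \<noteq> 0"
      moreover have "p 2 0 - p 1 y = p 1 (- y)" by (simp add: p_diff)
      ultimately show "p 1 y \<in> S \<and> p 2 0 - p 1 y \<in> S \<and> p 1 y \<noteq> p 2 0 - p 1 y"
        by (simp add: pos p_eq)
    qed
  qed (use fin p_0 in simp)
  moreover have "finite {y. y \<noteq> 0 \<and> \<not> \<sigma> 1 y \<and> \<not> \<sigma> 1 (- y)}" (is "finite ?Y")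
  proof (rule inj_on_finite)
    show "inj_on (\<lambda>y. - p 1 y) ?Y" by (auto simp: inj_on_def p_eq)
    show "(\<lambda>y. - p 1 y) ` ?Y \<subseteq> {r \<in> S. p (- 2) 0 - r \<in> S \<and> r \<noteq> p (- 2) 0 - r}"
    proof clarify
      fix y assume "\<not> \<sigma> 1 y" "\<not> \<sigma> 1 (- y)" "y \<noteq> 0"
      moreover have "p (- 2) 0 - - p 1 y = - p 1 (- y)" by (simp add: p_diff p_neg[symmetric])
      ultimately show "- p 1 y \<in> S \<and> p (- 2) 0 - - p 1 y \<in> S \<and> - p 1 y \<noteq> p (- 2) 0 - - p 1 y"
        by (simp add: pos p_eq del: diff_minus_eq_add)
    qed
  qed (use fin p_0 in simp)
  ultimately have "finite (insert 0 (?X \<union> ?Y))" by simp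
  then have "finite {y. \<sigma> 1 y = \<sigma> 1 (- y)}" by (rule rev_finite_subset) auto
  then show False
    using half_plane_sign_contradiction[of \<sigma>] step[of 1 0] step[of 0 1] by simp
qed

end

section \<open>Weight modules of the toroidal algebra\<close>

context vector_space
begin

lemma span_Union_direct_sum:
  assumes "is_direct_sum F"
  shows "span (\<Union>F) = UNIV"
proof -
  have "v \<in> span (\<Union>F)" for v
  proof -
    obtain f where f: "\<forall>S\<in>F. f S \<in> S" "\<forall>S. S \<notin> F \<longrightarrow> f S = 0" "v = (\<Sum>S | f S \<noteq> 0. f S)"
      using assms unfolding is_direct_sum_def by blast
    show ?thesis unfolding f(3)
    proof (rule span_sum)
      fix S assume "S \<in> {S. f S \<noteq> 0}"
      then have "S \<in> F" "f S \<in> S" using f by auto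
      then show "f S \<in> span (\<Union>F)" by (intro span_base) blast
    qed
  qed
  then show ?thesis by blast
qed

text \<open>The vectors with such a family form a subspace containing every member of
  \<open>F\<close>. The conditions on f are those of \<open>is_direct_sum\<close>, so that
  uniqueness can be applied to it.\<close>

lemma span_Union_family:
  assumes "\<And>S. S \<in> F \<Longrightarrow> subspace S" and "z \<in> span (\<Union>F)"
  obtains f where "\<forall>S\<in>F. f S \<in> S" "\<forall>S. S \<notin> F \<longrightarrow> f S = 0" "finite {S. f S \<noteq> 0}"
    "z = (\<Sum>S | f S \<noteq> 0. f S)"
proof -
  define P where "P f z \<longleftrightarrow> (\<forall>S\<in>F. f S \<in> S) \<and> (\<forall>S. S \<notin> F \<longrightarrow> f S = 0) \<and> finite {S. f S \<noteq> 0} \<and>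
    z = (\<Sum>S | f S \<noteq> 0. f S)" for f z
  have "subspace {z. \<exists>f. P f z}"
  proof (rule subspaceI)
    show "0 \<in> {z. \<exists>f. P f z}"
      using assms(1) by (auto simp: P_def subspace_0 intro!: exI[of _ "\<lambda>_. 0"])
  next
    fix x y assume "x \<in> {z. \<exists>f. P f z}" "y \<in> {z. \<exists>f. P f z}"
    then obtain f g where fg: "P f x" "P g y" by blast
    let ?A = "{S. f S \<noteq> 0} \<union> {S. g S \<noteq> 0}"
    have A: "finite ?A" using fg by (simp add: P_def)
    have "x = sum f ?A" "y = sum g ?A"
      using fg A by (auto simp: P_def intro!: sum.mono_neutral_left)
    moreover have "(\<Sum>S | f S + g S \<noteq> 0. f S + g S) = (\<Sum>S\<in>?A. f S + g S)"
      by (rule sum.mono_neutral_left[OF A]) auto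
    moreover have "finite {S. f S + g S \<noteq> 0}" by (rule finite_subset[OF _ A]) auto
    ultimately have "P (\<lambda>S. f S + g S) (x + y)"
      using fg assms(1) by (auto simp: P_def sum.distrib intro: subspace_add)
    then show "x + y \<in> {z. \<exists>f. P f z}" by blast
  next
    fix c x assume "x \<in> {z. \<exists>f. P f z}"
    then obtain f where f: "P f x" by blast
    show "scale c x \<in> {z. \<exists>f. P f z}"
    \<comment> \<open>Scaling by 0 empties the support, so the zero family is used there.\<close>
    proof (cases "c = 0")
      case True
      then show ?thesis
        using assms(1) by (auto simp: P_def subspace_0 intro!: exI[of _ "\<lambda>_. 0"])
    next
      case False
      then have "P (\<lambda>S. scale c (f S)) (scale c x)"
        using f assms(1) by (auto simp: P_def scale_sum_right intro: subspace_scale)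
      then show ?thesis by blast
    qed
  qed
  moreover have "\<Union>F \<subseteq> {z. \<exists>f. P f z}"
  proof clarify
    fix S z assume "S \<in> F" "z \<in> S"
    have "{S'. (if S' = S then z else 0) \<noteq> 0} = (if z = 0 then {} else {S})" by auto
    then have "P (\<lambda>S'. if S' = S then z else 0) z"
      using \<open>S \<in> F\<close> \<open>z \<in> S\<close> assms(1) by (auto simp: P_def subspace_0)
    then show "\<exists>f. P f z" by blast
  qed
  ultimately have "span (\<Union>F) \<subseteq> {z. \<exists>f. P f z}" by (intro span_minimal)
  then show thesis using assms(2) that unfolding P_def by blast
qed

text \<open>z has one decomposition with component 0 at \<open>S\<close> and another concentrated at
  \<open>S\<close>; uniqueness identifies them.\<close>

lemma direct_sum_Int_span_others:
  assumes sum: "is_direct_sum F" and F: "\<And>S. S \<in> F \<Longrightarrow> subspace S"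
    and S: "S \<in> F" and z: "z \<in> S" "z \<in> span (\<Union>(F - {S}))"
  shows "z = 0"
proof -
  obtain f where f: "\<forall>S\<in>F - {S}. f S \<in> S" "\<forall>S'. S' \<notin> F - {S} \<longrightarrow> f S' = 0" "finite {S. f S \<noteq> 0}"
    "z = (\<Sum>S | f S \<noteq> 0. f S)"
    using span_Union_family[of "F - {S}" z] F z(2) by blast
  define Q where "Q f \<longleftrightarrow> (\<forall>S\<in>F. f S \<in> S) \<and> (\<forall>S. S \<notin> F \<longrightarrow> f S = 0) \<and>
    finite {S. f S \<noteq> 0} \<and> z = (\<Sum>S | f S \<noteq> 0. f S)" for f
  define g where "g = (\<lambda>S'. if S' = S then z else 0)"
  have "f S = 0" using f(2) by blast
  then have "f S \<in> S" using subspace_0[OF F[OF S]] by simp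
  then have "f S' \<in> S'" if "S' \<in> F" for S' using f(1) that by (cases "S' = S") auto
  moreover have "\<forall>S'. S' \<notin> F \<longrightarrow> f S' = 0" using f(2) by blast
  ultimately have "Q f" using f(3,4) by (simp add: Q_def)
  have "{S'. g S' \<noteq> 0} = (if z = 0 then {} else {S})" by (auto simp: g_def)
  then have "finite {S'. g S' \<noteq> 0}" "z = (\<Sum>S' | g S' \<noteq> 0. g S')" by (simp_all add: g_def)
  moreover have "\<forall>S'\<in>F. g S' \<in> S'" "\<forall>S'. S' \<notin> F \<longrightarrow> g S' = 0"
    using F S z(1) subspace_0 by (simp_all add: g_def)
  ultimately have "Q g" unfolding Q_def by (intro conjI)
  moreover have "\<exists>!f. Q f"
    using sum unfolding is_direct_sum_def Q_def by (rule spec)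
  ultimately have "f = g" using \<open>Q f\<close> by blast
  then show "z = 0" using \<open>f S = 0\<close> by (simp add: g_def)
qed

end

section \<open>Orthogonality for the invariant form\<close>

context simple_lie_algebra_with_form
begin

text \<open>By nondegeneracy and finite dimension every linear functional is pairing with some x;
  the one chosen is the coordinate of h in a basis extending h and a basis of
  \<open>U\<close>.\<close>

lemma form_separates_subspace:
  assumes "subspace U" "h \<notin> U"
  obtains x where "form x h \<noteq> 0" "\<And>u. u \<in> U \<Longrightarrow> form x u = 0"
proof -
  obtain C where C: "finite C" "span C = UNIV" using finite_dim_UNIV by (auto simp: finite_dim_def)
  obtain B0 where B0: "B0 \<subseteq> U" "independent B0" "U \<subseteq> span B0" by (rule maximal_independent_subset)
  have "h \<notin> span B0" using span_minimal[OF B0(1) assms(1)] assms(2) by blast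
  then have "independent (insert h B0)" using B0(2) by (rule independent_insertI)
  then obtain B where B: "insert h B0 \<subseteq> B" "independent B" "UNIV \<subseteq> span B"
    by (rule maximal_independent_subset_extend[OF subset_UNIV])
  then have span_B: "span B = UNIV" by blast
  have "finite B" using independent_span_bound[OF C(1) B(2)] C(2) by simp
  interpret finite_dimensional_vector_space scal B
    by unfold_locales (fact B span_B \<open>finite B\<close>)+
  \<comment> \<open>T x is the functional \<open>form x\<close> written in coordinates of
    \<open>B\<close>. Thus T x = h says that x pairs to 1 with h and to 0 with the rest of
    \<open>B\<close>.\<close>
  define T where "T x = (\<Sum>b\<in>B. scal (form x b) b)" for x
  have lin: "Vector_Spaces.linear scal scal T"
    unfolding vector_space_linear_iff[OF vector_space_axioms vector_space_axioms] T_def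
    by (simp add: form_add form_scal scale_left_distrib sum.distrib scale_sum_right)
  have coeffs: "form x b = c b" if "T x = (\<Sum>b\<in>B. scal (c b) b)" "b \<in> B" for x c b
  proof -
    have "(\<Sum>b\<in>B. scal (form x b - c b) b) = 0"
      using that(1) by (simp add: T_def scale_left_diff_distrib sum_subtractf)
    then show ?thesis using independentD[OF B(2) \<open>finite B\<close> order_refl _ that(2)] by fastforce
  qed
  have annihilator: "subspace {y. form x y = 0}" for x
    by (auto simp: subspace_def form_add form_scal)
  have "inj T"
  proof (rule injI)
    fix x y assume eq: "T x = T y"
    have "B \<subseteq> {z. form (x - y) z = 0}"
      using coeffs[of x "form y"] eq form_add(1)[of x "- y"] by (auto simp: T_def)
    then have "form (x - y) z = 0" for z
      using span_minimal[OF _ annihilator] span_B by blast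
    then show "x = y" using nondegenerate_form[of "x - y"] by simp
  qed
  then have "surj T" by (rule linear_inj_imp_surj[OF lin])
  then obtain x where x: "T x = h" by (metis surjD)
  have "h = (\<Sum>b\<in>B. scal (if b = h then 1 else 0) b)"
    using B(1) \<open>finite B\<close> by (simp add: if_distribR if_distrib[of scal] cong: if_cong)
  then have xb: "form x b = (if b = h then 1 else 0)" if "b \<in> B" for b
    using coeffs[of x "\<lambda>b. if b = h then 1 else 0" b] x that by simp
  have "h \<notin> B0" using \<open>h \<notin> span B0\<close> span_base by blast
  then have "B0 \<subseteq> {y. form x y = 0}" using xb B(1) by auto
  then have "U \<subseteq> {y. form x y = 0}" using span_minimal[OF _ annihilator] B0(3) by blast
  then show thesis using that[of x] xb[of h] B(1) by auto
qed

text \<open>Polarisation.\<close>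

lemma isotropic_subspace_form_zero:
  assumes "subspace U" "\<And>x. x \<in> U \<Longrightarrow> form x x = 0" "x \<in> U" "y \<in> U"
  shows "form x y = 0"
  using assms(2)[of "x + y"] assms(2)[of x] assms(2)[of y] subspace_add[OF assms(1,3,4)] assms(3,4)
  by (simp add: form_add symmetric_form[of y x])

lemma loop_elt_add: "loop_elt (X + Y) r = loop_elt X r + loop_elt Y r"
  by (simp add: loop_elt_def single_add)

lemma loop_elt_scal: "loop_elt (scal c X) r = toroidal_scale scal c (loop_elt X r)"
  by (simp add: loop_elt_def toroidal_scale_def M_single)

lemma form_nonzero: "\<exists>X Y. form X Y \<noteq> 0"
  using simple nondegenerate_form unfolding simple_def by metis

end

text \<open>The generating weight vector is represented by its consequences: V is nonzero, and the
  K_i act by scalars that do not all vanish.\<close>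

locale toroidal_weight_module =
  simple_lie_algebra_with_form scal bracket form +
  T: lie_module "toroidal_scale scal" "toroidal_bracket scal bracket form" scaleV act
  for scal :: "complex \<Rightarrow> 'g::ab_group_add \<Rightarrow> 'g" and bracket and form
    and scaleV :: "complex \<Rightarrow> 'v::ab_group_add \<Rightarrow> 'v"
    and act :: "('g, 'n::finite) toroidal \<Rightarrow> 'v \<Rightarrow> 'v" +
  fixes H :: "'g set" and level :: "complex ^ 'n"
  assumes cartan: "cartan_subalgebra H"
    and weight_module: "T.weight_module (toroidal_cartan scal H)"
    and finite_dim: "T.finite_dim_weight_spaces (toroidal_cartan scal H)"
    and act_central: "act (central_elt i) v = scaleV (level $ i) v"
    and level_nonzero: "level \<noteq> 0"
    and nontrivial: "\<exists>v::'v. v \<noteq> 0"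
begin

abbreviation "CS \<equiv> toroidal_cartan scal H :: ('g, 'n) toroidal set"

lemma act_add_left: "act (x + y) v = act x v + act y v"
  and act_scale_left: "act (toroidal_scale scal z x) v = scaleV z (act x v)"
  and act_add_right: "act x (v + w) = act x v + act x w"
  and act_scale_right: "act x (scaleV z v) = scaleV z (act x v)"
  using T.linear_act_left T.linear_act_right
  unfolding vector_space_linear_iff[OF T.vector_space_axioms T.V.vector_space_axioms]
    vector_space_linear_iff[OF T.V.vector_space_axioms T.V.vector_space_axioms]
  by blast+

lemma act_zero [simp]: "act 0 v = 0" "act x 0 = 0"
  using act_add_left[of 0 0 v] act_add_right[of x 0 0] by simp_all

lemma act_sum_left: "act (sum f I) v = (\<Sum>i\<in>I. act (f i) v)"
  by (induction I rule: infinite_finite_induct) (simp_all add: act_add_left)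

abbreviation loop_act :: "'g \<Rightarrow> int ^ 'n \<Rightarrow> 'v \<Rightarrow> 'v" where
  "loop_act X r \<equiv> act (loop_elt X r)"

lemma loop_act_zero [simp]: "loop_act 0 r v = 0"
  by (simp add: loop_elt_def flip: zero_prod_def)

lemma loop_act_commutator:
  "loop_act X r (loop_act Y t v) - loop_act Y t (loop_act X r v) =
     loop_act (bracket X Y) (r + t) v +
     scaleV (if r + t = 0 then form X Y * int_pairing level r else 0) v"
proof -
  have "loop_act X r (loop_act Y t v) - loop_act Y t (loop_act X r v) =
      loop_act (bracket X Y) (r + t) v +
      (\<Sum>i\<in>UNIV. scaleV (if r + t = 0 then form X Y * of_int (r $ i) else 0) (scaleV (level $ i) v))"
    by (simp add: T.act_bracket[symmetric] toroidal_bracket_loop_loop act_add_left act_sum_left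
        act_scale_left act_central)
  also have "(\<Sum>i\<in>UNIV. scaleV (if r + t = 0 then form X Y * of_int (r $ i) else 0) (scaleV (level $ i) v)) =
      scaleV (if r + t = 0 then form X Y * int_pairing level r else 0) v"
    by (simp add: int_pairing_def sum_distrib_left T.V.scale_sum_left algebra_simps)
  finally show ?thesis .
qed

lemma loop_act_commutator_0:
  "loop_act X 0 (loop_act Y t v) - loop_act Y t (loop_act X 0 v) = loop_act (bracket X Y) t v"
  using loop_act_commutator[of X 0 Y t v] by (simp add: int_pairing_def)

section \<open>Faithfulness of the action of the simple Lie algebra\<close>

lemma lie_ideal_trivial:
  assumes "lie_ideal I" "X \<notin> I" "Y \<in> I"
  shows "Y = 0"
  using simple assms unfolding simple_def by blast

text \<open>The common kernel over all degrees is an ideal. It is proper because [Y(e_i), Z(-e_i)]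
  contains the multiple (Y,Z) K_i, which acts by a nonzero scalar for suitable Y, Z and i.\<close>

lemma loop_act_all_degrees_faithful:
  assumes "\<And>r v. loop_act X r v = 0"
  shows "X = 0"
proof -
  let ?J = "{X. \<forall>r v. loop_act X r v = 0}"
  have "lie_ideal ?J"
    unfolding lie_ideal_def subspace_def
    by (auto simp: loop_elt_add loop_elt_scal act_add_left act_scale_left
        loop_act_commutator_0[symmetric])
  moreover obtain Y Z where "form Y Z \<noteq> 0" using form_nonzero by blast
  obtain i where "level $ i \<noteq> 0" using level_nonzero by (auto simp: vec_eq_iff)
  obtain v :: 'v where "v \<noteq> 0" using nontrivial by blast
  have "Y \<notin> ?J"
  proof
    assume "Y \<in> ?J"
    then have "loop_act (bracket Y Z) 0 v = 0"
      by (simp flip: loop_act_commutator_0)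
    with \<open>Y \<in> ?J\<close> have "scaleV (form Y Z * level $ i) v = 0"
      using loop_act_commutator[of Y "axis i 1" Z "- axis i 1" v] by (simp add: int_pairing_axis)
    then show False using \<open>form Y Z \<noteq> 0\<close> \<open>level $ i \<noteq> 0\<close> \<open>v \<noteq> 0\<close> by simp
  qed
  ultimately show ?thesis using lie_ideal_trivial assms by blast
qed

text \<open>The kernel in degree 0 is an ideal too. If Y(0) acts as zero, so does [Y(0), Z(r)] =
  [Y,Z](r) in every degree, which reduces to the previous lemma.\<close>

lemma loop_act_faithful:
  assumes "\<And>v. loop_act X 0 v = 0"
  shows "X = 0"
proof -
  let ?I = "{X. \<forall>v. loop_act X 0 v = 0}"
  have "lie_ideal ?I"
    unfolding lie_ideal_def subspace_def
    by (auto simp: loop_elt_add loop_elt_scal act_add_left act_scale_left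
        loop_act_commutator_0[symmetric])
  moreover obtain Y Z where "bracket Y Z \<noteq> 0" using simple unfolding simple_def by blast
  have "Y \<notin> ?I"
  proof
    assume "Y \<in> ?I"
    then have "loop_act (bracket Y Z) r v = 0" for r v
      by (simp flip: loop_act_commutator_0)
    then show False using loop_act_all_degrees_faithful \<open>bracket Y Z \<noteq> 0\<close> by blast
  qed
  ultimately show ?thesis using lie_ideal_trivial assms by blast
qed

section \<open>Consequences of the diagonal action of the Cartan subalgebra\<close>

lemma subspace_weight_space: "T.V.subspace (T.weight_space S \<mu>)"
  unfolding T.weight_space_def T.V.subspace_def
  by (auto simp: act_add_right act_scale_right T.V.scale_right_distrib mult.commute)

lemma span_weight_spaces: "T.V.span (\<Union>(range (T.weight_space CS))) = UNIV"
  using T.V.span_Union_direct_sum weight_module unfolding T.weight_module_def by blast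

lemma loop_act_eq_0_if_weight_spaces:
  assumes "\<And>\<mu> v. v \<in> T.weight_space CS \<mu> \<Longrightarrow> loop_act X 0 v = 0"
  shows "X = 0"
proof (rule loop_act_faithful)
  fix v
  have "T.V.subspace {v. loop_act X 0 v = 0}"
    by (auto simp: T.V.subspace_def act_add_right act_scale_right)
  then have "T.V.span (\<Union>(range (T.weight_space CS))) \<subseteq> {v. loop_act X 0 v = 0}"
    by (intro T.V.span_minimal) (use assms in auto)
  then show "loop_act X 0 v = 0" unfolding span_weight_spaces by blast
qed

lemma CS_mem:
  "X \<in> H \<Longrightarrow> loop_elt X 0 \<in> CS" "central_elt i \<in> CS"
  unfolding toroidal_cartan_def by (auto intro!: T.span_base)

lemma loop_act_weight_space:
  "X \<in> H \<Longrightarrow> v \<in> T.weight_space CS \<mu> \<Longrightarrow> loop_act X 0 v = scaleV (\<mu> (loop_elt X 0)) v"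
  using CS_mem(1) by (simp add: T.weight_space_def)

text \<open>Elements of \<open>H\<close> act by scalars on each weight space, so their brackets act
  as zero there, and faithfulness applies.\<close>

lemma cartan_abelian:
  assumes "X \<in> H" "Y \<in> H"
  shows "bracket X Y = 0"
proof (rule loop_act_eq_0_if_weight_spaces)
  fix \<mu> v assume "v \<in> T.weight_space CS \<mu>"
  then show "loop_act (bracket X Y) 0 v = 0"
    using loop_act_commutator_0[of X Y 0 v] assms
    by (simp add: loop_act_weight_space act_scale_right mult.commute)
qed

text \<open>Split Y(0) v = p + z with p in the weight space of v. In [h,Y](0) v = (h(0) - \<mu>(h))
  (p + z) the part p is killed, and h(0) preserves the span of the other weight spaces.\<close>

lemma bracket_span_off_diagonal:
  assumes v: "v \<in> T.weight_space CS \<mu>" and X: "X \<in> span {bracket h Y | h Y. h \<in> H}"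
  shows "loop_act X 0 v \<in> T.V.span (\<Union>(range (T.weight_space CS) - {T.weight_space CS \<mu>}))"
    (is "_ \<in> ?Z")
proof -
  have Z: "T.V.subspace ?Z" by (rule T.V.subspace_span)
  have Z_stable: "loop_act h 0 z \<in> ?Z" if "h \<in> H" "z \<in> ?Z" for h z
  proof -
    have "T.V.subspace {z. loop_act h 0 z \<in> ?Z}"
      by (auto simp: T.V.subspace_def act_add_right act_scale_right T.V.subspace_0[OF Z]
          intro: T.V.span_add T.V.span_scale)
    moreover have "\<Union>(range (T.weight_space CS) - {T.weight_space CS \<mu>}) \<subseteq> {z. loop_act h 0 z \<in> ?Z}"
    proof clarify
      fix \<nu> z assume z: "z \<in> T.weight_space CS \<nu>" "T.weight_space CS \<nu> \<noteq> T.weight_space CS \<mu>"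
      then have "z \<in> ?Z" by (intro T.V.span_base) blast
      then show "loop_act h 0 z \<in> ?Z"
        using loop_act_weight_space[OF that(1) z(1)] T.V.span_scale by simp
    qed
    ultimately show ?thesis using T.V.span_minimal that(2) by blast
  qed
  have gen: "loop_act (bracket h Y) 0 v \<in> ?Z" if h: "h \<in> H" for h Y
  proof -
    let ?W = "T.weight_space CS \<mu>"
    have "\<Union>(range (T.weight_space CS)) = ?W \<union> \<Union>(range (T.weight_space CS) - {?W})" by blast
    then have "loop_act Y 0 v \<in> T.V.span (?W \<union> \<Union>(range (T.weight_space CS) - {?W}))"
      using span_weight_spaces by (metis UNIV_I)
    then obtain p z where pz: "loop_act Y 0 v = p + z" "p \<in> T.V.span ?W" "z \<in> ?Z"
      unfolding T.V.span_Un by blast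
    have "p \<in> ?W" using pz(2) T.V.span_eq_iff subspace_weight_space by blast
    then have "loop_act (bracket h Y) 0 v = loop_act h 0 z - scaleV (\<mu> (loop_elt h 0)) z"
      using loop_act_commutator_0[of h Y 0 v] loop_act_weight_space[OF h] v
      by (simp add: act_scale_right pz(1) act_add_right T.V.scale_right_distrib algebra_simps)
    then show ?thesis
      using Z_stable[OF h pz(3)] pz(3) T.V.span_diff T.V.span_scale by simp
  qed
  have "subspace {X. loop_act X 0 v \<in> ?Z}"
    by (auto simp: subspace_def loop_elt_add loop_elt_scal act_add_left act_scale_left
        T.V.subspace_0[OF Z] intro: T.V.span_add T.V.span_scale)
  then have "span {bracket h Y | h Y. h \<in> H} \<subseteq> {X. loop_act X 0 v \<in> ?Z}"
    by (rule span_minimal[rotated]) (use gen in blast)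
  then show ?thesis using X by blast
qed

text \<open>Such an h maps a weight space both into itself and into the span of the others, hence to
  0.\<close>

lemma cartan_Int_bracket_span:
  assumes "h \<in> H" "h \<in> span {bracket h Y | h Y. h \<in> H}"
  shows "h = 0"
proof (rule loop_act_eq_0_if_weight_spaces)
  fix \<mu> v assume v: "v \<in> T.weight_space CS \<mu>"
  show "loop_act h 0 v = 0"
  proof (rule T.V.direct_sum_Int_span_others)
    show "is_direct_sum (range (T.weight_space CS))"
      using weight_module unfolding T.weight_module_def .
    show "loop_act h 0 v \<in> T.weight_space CS \<mu>"
      using loop_act_weight_space[OF assms(1) v] v T.V.subspace_scale[OF subspace_weight_space] by simp
    show "loop_act h 0 v \<in> T.V.span (\<Union>(range (T.weight_space CS) - {T.weight_space CS \<mu>}))"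
      by (rule bracket_span_off_diagonal[OF v assms(2)])
  qed (use subspace_weight_space in auto)
qed

lemma cartan_anisotropic_exists:
  obtains h where "h \<in> H" "form h h \<noteq> 0"
proof -
  let ?U = "span {bracket h Y | h Y. h \<in> H}"
  have H: "subspace H" "normalizer H = H"
    using cartan by (auto simp: cartan_subalgebra_def lie_subalgebra_def)
  have "H \<noteq> {0}"
  proof
    assume "H = {0}"
    moreover have "normalizer {0} = UNIV" by (auto simp: normalizer_def)
    ultimately have "(UNIV :: 'g set) = {0}" using H(2) by metis
    then show False using form_nonzero by (metis UNIV_I form_zero(1) singletonD)
  qed
  then obtain h where h: "h \<in> H" "h \<noteq> 0" using subspace_0[OF H(1)] by blast
  then have "h \<notin> ?U" using cartan_Int_bracket_span by blast
  then obtain x where x: "form x h \<noteq> 0" "\<And>u. u \<in> ?U \<Longrightarrow> form x u = 0"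
    using form_separates_subspace[OF subspace_span] by blast
  \<comment> \<open>By invariance ([x,y],z) = (x,[y,z]), which vanishes since x is orthogonal to
    [H,g]. So x centralises \<open>H\<close> and lies in its normaliser.\<close>
  have "bracket x y = 0" if "y \<in> H" for y
  proof (rule nondegenerate_form)
    fix z
    have "bracket y z \<in> ?U" using that by (intro span_base) blast
    then show "form (bracket x y) z = 0"
      using x(2) invariant_form by (simp add: invariant_form_def)
  qed
  then have "x \<in> normalizer H" using subspace_0[OF H(1)] by (simp add: normalizer_def)
  then have "x \<in> H" using H(2) by simp
  \<comment> \<open>Were every vector of \<open>H\<close> isotropic, polarisation would make the
    pairing of x with h vanish.\<close>
  then show thesis using isotropic_subspace_form_zero[OF H(1) _ _ h(1)] x(1) that by blast
qed

text \<open>Both sides are linear in x, so generators suffice. For X(0) the bracket vanishes: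
  \<open>H\<close> is abelian, and the cocycle carries the degree 0 of the left factor.\<close>

lemma toroidal_bracket_CS_loop:
  assumes h: "h \<in> H" and x: "x \<in> CS"
  shows "toroidal_bracket scal bracket form x (loop_elt h r) =
    toroidal_scale scal (int_pairing (snd (snd x)) r) (loop_elt h r)"
proof -
  let ?E = "{x. toroidal_bracket scal bracket form x (loop_elt h r) =
    toroidal_scale scal (int_pairing (snd (snd x)) r) (loop_elt h r)}"
  note lin = T.linear_bracket_left[unfolded vector_space_linear_iff[OF T.vector_space_axioms T.vector_space_axioms], rule_format]
  have pairing_0: "int_pairing 0 r = 0" by (simp add: int_pairing_def)
  have "T.subspace ?E"
  proof (rule T.subspaceI)
    show "0 \<in> ?E"
      using T.linear_bracket_left lin by (simp add: pairing_0) (metis T.scale_zero_left)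
  next
    fix x y assume "x \<in> ?E" "y \<in> ?E"
    moreover have "int_pairing (snd (snd (x + y))) r = int_pairing (snd (snd x)) r + int_pairing (snd (snd y)) r"
      by (simp add: int_pairing_def distrib_right sum.distrib)
    ultimately show "x + y \<in> ?E" by (simp add: lin T.scale_left_distrib)
  next
    fix c x assume "x \<in> ?E"
    moreover have "int_pairing (snd (snd (toroidal_scale scal c x))) r = c * int_pairing (snd (snd x)) r"
      by (cases x) (simp add: int_pairing_def toroidal_scale_def sum_distrib_left mult.assoc)
    ultimately show "toroidal_scale scal c x \<in> ?E" by (simp add: lin)
  qed
  moreover have "loop_elt X 0 \<in> ?E" if "X \<in> H" for X
    using toroidal_bracket_loop_loop[of X 0 h r] cartan_abelian[OF that h]
    by (simp add: loop_elt_def pairing_0 flip: zero_prod_def cong: if_cong)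
  moreover have "central_elt i \<in> ?E" for i
    by (simp add: toroidal_bracket_central) (simp add: central_elt_def pairing_0)
  moreover have "degree_derivation i \<in> ?E" for i
    by (simp add: toroidal_bracket_degree_loop)
      (simp add: degree_derivation_def int_pairing_def axis_def if_distrib if_distribR cong: if_cong)
  ultimately have "CS \<subseteq> ?E" unfolding toroidal_cartan_def by (intro T.span_minimal) auto
  then show ?thesis using x by blast
qed

text \<open>The weight \<mu> is shifted by the pairing of t with the d-component
  \<open>snd (snd x)\<close>, the eigenvalue of x on h(t).\<close>

lemma heisenberg_module_cartan:
  assumes h: "h \<in> H"
  shows "heisenberg_module scaleV (loop_act h) (form h h *s level)
    (\<lambda>t. T.weight_space CS (\<lambda>x. \<mu> x + int_pairing (snd (snd x)) t))"
proof (intro heisenberg_module.intro heisenberg_module_axioms.intro T.V.vector_space_axioms)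
  show "Vector_Spaces.linear scaleV scaleV (loop_act h r)" for r
    by (rule T.linear_act_right)
  show "loop_act h r (loop_act h t v) - loop_act h t (loop_act h r v) =
      (if r + t = 0 then scaleV (int_pairing (form h h *s level) r) v else 0)" for r t v
    using loop_act_commutator[of h r h t v] bracket_self
    by (simp add: int_pairing_def sum_distrib_left mult.assoc)
  show "T.V.subspace (T.weight_space CS (\<lambda>x. \<mu> x + int_pairing (snd (snd x)) t))" for t
    by (rule subspace_weight_space)
  show "\<exists>B. finite B \<and> T.weight_space CS (\<lambda>x. \<mu> x + int_pairing (snd (snd x)) t) \<subseteq> T.V.span B" for t
  proof -
    obtain B where "finite B" "T.V.span B = T.weight_space CS (\<lambda>x. \<mu> x + int_pairing (snd (snd x)) t)"
      using finite_dim unfolding T.finite_dim_weight_spaces_def by (elim allE exE conjE)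
    then show ?thesis by (intro exI[of _ B]) simp
  qed
  show "loop_act h r v \<in> T.weight_space CS (\<lambda>x. \<mu> x + int_pairing (snd (snd x)) (t + r))"
    if "v \<in> T.weight_space CS (\<lambda>x. \<mu> x + int_pairing (snd (snd x)) t)" for v t r
    unfolding T.weight_space_def
  proof clarify
    fix p k d assume x: "(p, k, d) \<in> CS"
    have "act (p, k, d) (loop_act h r v) - loop_act h r (act (p, k, d) v) = scaleV (int_pairing d r) (loop_act h r v)"
      using toroidal_bracket_CS_loop[OF h x, of r]
      by (simp add: T.act_bracket[symmetric] act_scale_left)
    moreover have "act (p, k, d) v = scaleV (\<mu> (p, k, d) + int_pairing d t) v"
      using that x by (auto simp: T.weight_space_def)
    ultimately show "act (p, k, d) (loop_act h r v) =
        scaleV (\<mu> (p, k, d) + int_pairing (snd (snd (p, k, d))) (t + r)) (loop_act h r v)"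
      by (simp add: act_add_right act_scale_right int_pairing_add T.V.scale_left_distrib algebra_simps)
  qed
qed

theorem card_index_less_2: "CARD('n) < 2"
proof (rule ccontr)
  assume "\<not> ?thesis"
  then have card: "CARD('n) \<ge> 2" by simp
  obtain h where h: "h \<in> H" "form h h \<noteq> 0" by (rule cartan_anisotropic_exists)
  have "T.weight_space CS \<mu> = {0}" for \<mu>
  proof -
    have "form h h *s level \<noteq> 0" using h(2) level_nonzero by (auto simp: vec_eq_iff)
    then show ?thesis
      \<comment> \<open>Degree t = 0 is the weight space of \<mu> itself.\<close>
      using heisenberg_module.Wt_trivial[OF heisenberg_module_cartan[OF h(1), of \<mu>] card, of 0]
      by (simp add: int_pairing_def)
  qed
  then have "(UNIV :: 'v set) = T.V.span {0}"
    using span_weight_spaces by simp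
  also have "\<dots> = {0}" by simp
  finally show False using nontrivial by (metis UNIV_I singletonD)
qed

end

theorem mainTheorem3:
  fixes scal :: "complex \<Rightarrow> 'g::ab_group_add \<Rightarrow> 'g"
    and bracket :: "'g \<Rightarrow> 'g \<Rightarrow> 'g"
    and form :: "'g \<Rightarrow> 'g \<Rightarrow> complex"
    and H :: "'g set"
  assumes "CARD('n::finite) \<ge> 2"
    and "simple_lie_algebra_with_form scal bracket form"
    and "complex_lie_algebra.cartan_subalgebra scal bracket H"
  shows "\<not> (\<exists>(scaleV :: complex \<Rightarrow> 'v::ab_group_add \<Rightarrow> 'v)
              (act :: ('g, 'n) toroidal \<Rightarrow> 'v \<Rightarrow> 'v) v.
            lie_module (toroidal_scale scal) (toroidal_bracket scal bracket form) scaleV act \<and>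
            lie_module.weight_module scaleV act (toroidal_cartan scal H) \<and>
            lie_module.finite_dim_weight_spaces scaleV act (toroidal_cartan scal H) \<and>
            lie_module.weight_vector scaleV act (toroidal_cartan scal H) v \<and>
            lie_module.generated_by scaleV act v \<and>
            (\<exists>i. act (central_elt i) v \<noteq> 0))"
proof clarify
  fix scaleV :: "complex \<Rightarrow> 'v \<Rightarrow> 'v" and act :: "('g, 'n) toroidal \<Rightarrow> 'v \<Rightarrow> 'v" and v i
  assume mod: "lie_module (toroidal_scale scal) (toroidal_bracket scal bracket form) scaleV act"
    and wm: "lie_module.weight_module scaleV act (toroidal_cartan scal H)"
    and fd: "lie_module.finite_dim_weight_spaces scaleV act (toroidal_cartan scal H)"
    and wv: "lie_module.weight_vector scaleV act (toroidal_cartan scal H) v"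
    and gen: "lie_module.generated_by scaleV act v"
    and i: "act (central_elt i) v \<noteq> 0"
  interpret simple_lie_algebra_with_form scal bracket form by fact
  interpret T: lie_module "toroidal_scale scal" "toroidal_bracket scal bracket form" scaleV act by fact
  obtain \<mu> where \<mu>: "v \<noteq> 0" "v \<in> T.weight_space (toroidal_cartan scal H) \<mu>"
    using wv unfolding T.weight_vector_def by blast
  define level :: "complex ^ 'n" where "level = (\<chi> j. \<mu> (central_elt j))"
  have K: "act (central_elt j) v = scaleV (level $ j) v" for j
  proof -
    have "central_elt j \<in> toroidal_cartan scal H"
      unfolding toroidal_cartan_def by (intro T.span_base) blast
    then show ?thesis using \<mu>(2) by (simp add: T.weight_space_def level_def)
  qed
  have lin: "act x (u + w) = act x u + act x w" "act x (scaleV c u) = scaleV c (act x u)" for x u w c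
    using T.linear_act_right[of x]
    unfolding vector_space_linear_iff[OF T.V.vector_space_axioms T.V.vector_space_axioms] by blast+
  have act_0: "act 0 u = 0" "act x 0 = 0" for x u
  proof -
    have "act (0 + 0) u = act 0 u + act 0 u"
      using T.linear_act_left[of u]
      unfolding vector_space_linear_iff[OF T.vector_space_axioms T.V.vector_space_axioms] by blast
    then show "act 0 u = 0" by simp
    show "act x 0 = 0" using lin(1)[of x 0 0] by simp
  qed
  have central: "act (central_elt j) w = scaleV (level $ j) w" for j w
  proof -
    \<comment> \<open>As K_j is central, its eigenspace is a submodule; it contains the generator v
      and so is all of V.\<close>
    let ?E = "{w. act (central_elt j) w = scaleV (level $ j) w}"
    have "T.V.subspace ?E"
      by (auto simp: T.V.subspace_def lin act_0 T.V.scale_right_distrib mult.commute)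
    moreover have "act x w \<in> ?E" if "w \<in> ?E" for x w
      using that T.act_bracket[of "central_elt j" x w] by (simp add: toroidal_bracket_central act_0 lin)
    ultimately have "T.submodule ?E" unfolding T.submodule_def by blast
    then have "T.submodule hull {v} \<subseteq> ?E" by (intro hull_minimal) (use K in auto)
    then show ?thesis using gen unfolding T.generated_by_def by blast
  qed
  have "level \<noteq> 0" using i K[of i] by auto
  then interpret toroidal_weight_module scal bracket form scaleV act H level
    by unfold_locales (use assms(3) wm fd central \<mu>(1) in auto)
  show False using card_index_less_2 assms(1) by simp
qed

end
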